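(* Let $\alpha>1$ and $p,q>0$. (1) For any $p,q>0$ there exist $A,B\in\mathbb{M}_2^{++}$ such that $\widetilde{SG}_{\alpha,p}(A,B)\not\prec_{\log}R_{\alpha,q}(A,B)$. (2) If $p/q\ge\alpha$, then $R_{\alpha,q}(A,B)\prec_{\log}\widetilde{SG}_{\alpha,p}(A,B)$ holds for all $A,B\ge0$ with $s(A)\ge s(B)$. (3) Assume that $R_{\alpha,q}(A,B)\prec_{\log}\widetilde{SG}_{\alpha,p}(A,B)$ holds for all $A,B\in\mathbb{M}_2^{++}$. Then $p/q\ge1/2$.
   Context: Notation: $\mathbb{M}_n$ is the set of $n\times n$ complex matrices, $\mathbb{M}_n^+$ (resp. $\mathbb{M}_n^{++}$) the positive semidefinite (resp. positive definite) ones. $A\ge0$ (resp. $A>0$) means $A\in\mathbb{M}_n^+$ (resp. $A\in\mathbb{M}_n^{++}$) for some $n\in\mathbb{N}$; matrices appearing together have the same size. $s(A)$ is the support projection of $A\ge0$. $A^{-1}$ denotes the generalized inverse (the inverse on the support of $A$, zero on the kernel), and $A^r:=(A^{-1})^{-r}$ for $r<0$. For $A,B\ge0$ with $s(A)\ge s(B)$, $A\#_\alpha B:=A^{1/2}(A^{-1/2}BA^{-1/2})^{\alpha}A^{1/2}$ (for any $\alpha>0$). For $s(A)\ge s(B)$, $\widetilde{SG}_{\alpha,p}(A,B):=\bigl((A^{-p}\#_\alpha B^p)^{1/2}A^{2(1-\alpha)p}(A^{-p}\#_\alpha B^p)^{1/2}\bigr)^{1/p}$, and the Rényi mean is $R_{\alpha,p}(A,B):=\bigl(A^{\frac{1-\alpha}{2}p}B^{\alpha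 p}A^{\frac{1-\alpha}{2}p}\bigr)^{1/p}$. Log-majorization: for $X,Y\in\mathbb{M}_n^+$ with eigenvalues $\lambda_1(\cdot)\ge\dots\ge\lambda_n(\cdot)$ counted with multiplicity, $X\prec_{\log}Y$ means $\prod_{i=1}^k\lambda_i(X)\le\prod_{i=1}^k\lambda_i(Y)$ for $1\le k\le n$, with equality for $k=n$. *)

theory Defs
  imports Complex_Main
    "Jordan_Normal_Form.Matrix"
    "Jordan_Normal_Form.Conjugate"
    "Jordan_Normal_Form.Char_Poly"
    "Jordan_Normal_Form.Schur_Decomposition"
begin

text \<open>On type \<^typ>\<open>complex\<close> the relations \<open>0 \<le> z\<close> and \<open>0 < z\<close> entail that \<open>z\<close> is real.\<close>

definition psd_mats :: "nat \<Rightarrow> complex mat set" where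
  "psd_mats n = {A \<in> carrier_mat n n. mat_adjoint A = A \<and>
     (\<forall>v \<in> carrier_vec n. 0 \<le> (A *\<^sub>v v) \<bullet>c v)}"

definition pd_mats :: "nat \<Rightarrow> complex mat set" where
  "pd_mats n = {A \<in> carrier_mat n n. mat_adjoint A = A \<and>
     (\<forall>v \<in> carrier_vec n. v \<noteq> 0\<^sub>v n \<longrightarrow> 0 < (A *\<^sub>v v) \<bullet>c v)}"

definition loewner_le :: "complex mat \<Rightarrow> complex mat \<Rightarrow> bool" where
  "loewner_le A B \<longleftrightarrow> B - A \<in> psd_mats (dim_row A)"

text \<open>The orthogonal projection onto the orthogonal complement of the kernel: an orthogonal
  projection is determined by its kernel.\<close>

definition support_proj :: "complex mat \<Rightarrow> complex mat" where
  "support_proj A = (THE P. P \<in> carrier_mat (dim_row A) (dim_row A) \<and>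
     mat_adjoint P = P \<and> P * P = P \<and>
     (\<forall>v \<in> carrier_vec (dim_row A). P *\<^sub>v v = 0\<^sub>v (dim_row A) \<longleftrightarrow> A *\<^sub>v v = 0\<^sub>v (dim_row A)))"

text \<open>Functional calculus of a Hermitian matrix.  The result does not depend on the chosen
  unitary diagonalization, so the description is unique.\<close>

definition mat_fun :: "(real \<Rightarrow> real) \<Rightarrow> complex mat \<Rightarrow> complex mat" where
  "mat_fun f A = (THE X. \<exists>U d. U \<in> carrier_mat (dim_row A) (dim_row A) \<and>
     mat_adjoint U * U = 1\<^sub>m (dim_row A) \<and>
     A = U * mat_diag (dim_row A) (\<lambda>i. complex_of_real (d i)) * mat_adjoint U \<and>
     X = U * mat_diag (dim_row A) (\<lambda>i. complex_of_real (f (d i))) * mat_adjoint U)"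

text \<open>Since \<open>inverse 0 = 0\<close>, this is the inverse on the support and zero on the kernel.\<close>

definition gen_inverse :: "complex mat \<Rightarrow> complex mat" where
  "gen_inverse A = mat_fun inverse A"

text \<open>\<open>0 powr r = 0\<close> for every \<open>r\<close>; in particular the zeroth power of a positive
  semidefinite matrix is its support projection.\<close>

definition mat_rpow :: "complex mat \<Rightarrow> real \<Rightarrow> complex mat" where
  "mat_rpow A r = (if 0 \<le> r then mat_fun (\<lambda>x. x powr r) A
                   else mat_fun (\<lambda>x. x powr (- r)) (gen_inverse A))"

definition gmean :: "real \<Rightarrow> complex mat \<Rightarrow> complex mat \<Rightarrow> complex mat" where
  "gmean \<alpha> A B = mat_rpow A (1/2) *
     mat_rpow (mat_rpow A (- 1/2) * B * mat_rpow A (- 1/2)) \<alpha> * mat_rpow A (1/2)"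

definition SG_tilde :: "real \<Rightarrow> real \<Rightarrow> complex mat \<Rightarrow> complex mat \<Rightarrow> complex mat" where
  "SG_tilde \<alpha> p A B =
     mat_rpow (mat_rpow (gmean \<alpha> (mat_rpow A (- p)) (mat_rpow B p)) (1/2) *
               mat_rpow A (2 * (1 - \<alpha>) * p) *
               mat_rpow (gmean \<alpha> (mat_rpow A (- p)) (mat_rpow B p)) (1/2)) (1/p)"

definition renyi_mean :: "real \<Rightarrow> real \<Rightarrow> complex mat \<Rightarrow> complex mat \<Rightarrow> complex mat" where
  "renyi_mean \<alpha> p A B =
     mat_rpow (mat_rpow A ((1 - \<alpha>) / 2 * p) * mat_rpow B (\<alpha> * p) *
               mat_rpow A ((1 - \<alpha>) / 2 * p)) (1/p)"

text \<open>The eigenvalues of a matrix with real spectrum, in decreasing order and repeated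
  according to multiplicity; indices start at \<open>0\<close>.\<close>

definition eigvals_desc :: "complex mat \<Rightarrow> real list" where
  "eigvals_desc A = (THE ls. sorted_wrt (\<ge>) ls \<and>
     char_poly A = (\<Prod>x\<leftarrow>ls. [:- complex_of_real x, 1:]))"

text \<open>To be used for positive semidefinite matrices of equal size only.\<close>

definition log_majorized :: "complex mat \<Rightarrow> complex mat \<Rightarrow> bool"
    (infix "\<prec>\<^sub>l\<^sub>o\<^sub>g" 50) where
  "X \<prec>\<^sub>l\<^sub>o\<^sub>g Y \<longleftrightarrow>
     (\<forall>k \<in> {1..dim_row X}. (\<Prod>i<k. eigvals_desc X ! i) \<le> (\<Prod>i<k. eigvals_desc Y ! i)) \<and>
     (\<Prod>i<dim_row X. eigvals_desc X ! i) = (\<Prod>i<dim_row X. eigvals_desc Y ! i)"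

end

theory Submission
  imports Defs
begin

text \<open>For positive semidefinite \<open>A\<close>, \<open>B\<close> put \<open>C = A\<^sup>p\<^sup>/\<^sup>2 B\<^sup>p A\<^sup>p\<^sup>/\<^sup>2\<close>.  The \<open>p\<close>-th powers of the eigenvalues of
  \<open>SG_tilde\<close> are the eigenvalues of \<open>A\<^sup>r C\<^sup>\<alpha> A\<^sup>r\<close> with \<open>r = (1/2 - \<alpha>) p\<close>, so the positive part follows from the
  Araki--Lieb--Thirring log-majorization, applied twice.  That inequality is proved by interpolation:
  let \<open>h(s)\<close> be the product of the \<open>k\<close> largest eigenvalues of \<open>Y\<^sup>s X\<^sup>2\<^sup>s Y\<^sup>s\<close>, i.e. the largest factor by which
  \<open>X\<^sup>s Y\<^sup>s\<close> scales squared \<open>k\<close>-dimensional volumes (Cauchy--Binet); submultiplicativity of volume factors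
  gives \<open>h((s + t) / 2)\<^sup>2 \<le> h(s) h(t)\<close>, hence \<open>h(s) \<le> h(1) powr s\<close> for dyadic \<open>s\<close> and then for all \<open>s\<close> in the
  unit interval by continuity.  The negative parts compare the largest eigenvalues for explicit
  degenerating families of \<open>2 \<times> 2\<close> matrices.\<close>

section \<open>Adjoints and the spectral theorem\<close>

text \<open>Exterior powers are never constructed. An n by k matrix stands for the wedge product of
  its columns and its Gram determinant for the squared norm; this suffices because the norm of the
  exterior power is attained at a frame of leading eigenvectors.

  The obstacle throughout is singularity. Generalized inverses and zeroth powers are not continuous
  at singular matrices, so the semidefinite case is not reduced to the definite one by perturbing
  the matrices. The rules for powers are proved for semidefinite matrices directly, and the midpoint
  inequality uses an intertwining relation where invertible matrices would allow a similarity.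

  The two exponents in the positive part are \<alpha>q/p and 1/\<alpha>; that they are at most 1 is
  exactly p/q \<ge> \<alpha> and \<alpha> \<ge> 1. The equality of the full products is a
  determinant computation.

  In the first counterexample the rates \<open>T^2\<close> and \<open>T\<close> do not depend on p
  and q, so it works for all of them. In the last one, a leading eigenvector of B with squared
  second component \<sigma> contributes \<open>u^q \<sigma>\<close> to the q-th power of the Renyi
  mean, while \<open>SG_tilde\<close> stays bounded as long as \<open>u^(2p) \<sigma>\<close> does.
  Growth therefore requires q > 2p, which is where 1/2 comes from.\<close>

lemma mat_adjoint_dim [simp]: "dim_row (mat_adjoint A) = dim_col A" "dim_col (mat_adjoint A) = dim_row A"
  by (auto simp: mat_adjoint_def)

lemma mat_adjoint_carrier [simp]: "mat_adjoint A \<in> carrier_mat n m \<longleftrightarrow> A \<in> carrier_mat m n"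
  unfolding carrier_mat_def by (simp only: mem_Collect_eq mat_adjoint_dim conj_commute)

lemma mat_adjoint_index [simp]:
  "i < dim_col A \<Longrightarrow> j < dim_row A \<Longrightarrow> mat_adjoint A $$ (i, j) = conjugate (A $$ (j, i))"
  by (simp add: mat_adjoint_def mat_of_rows_def)

lemma mat_adjoint_adjoint [simp]: "mat_adjoint (mat_adjoint A) = A"
  by (rule eq_matI) auto

lemma mult_carrier_square [simp]:
  "A \<in> carrier_mat n n \<Longrightarrow> B \<in> carrier_mat n n \<Longrightarrow> A * B \<in> carrier_mat n n"
  by (rule mult_carrier_mat)

lemma mat_adjoint_mult:
  fixes A B :: "complex mat"
  assumes "A \<in> carrier_mat n m" "B \<in> carrier_mat m k"
  shows "mat_adjoint (A * B) = mat_adjoint B * mat_adjoint A"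
  using assms by (intro eq_matI) (auto simp: scalar_prod_def mult.commute intro!: sum.cong)

lemma mat_adjoint_one [simp]: "mat_adjoint (1\<^sub>m n :: complex mat) = 1\<^sub>m n"
  by (rule eq_matI) auto

lemma det_mat_adjoint:
  fixes A :: "complex mat"
  assumes "A \<in> carrier_mat n n"
  shows "det (mat_adjoint A) = cnj (det A)"
proof -
  have "mat_adjoint A = map_mat cnj (transpose_mat A)"
    using assms by (intro eq_matI) auto
  moreover have "cnj (signof p) = signof p" for p :: "nat \<Rightarrow> nat"
    by (simp add: sign_def)
  then have "det (map_mat cnj (transpose_mat A)) = cnj (det (transpose_mat A))"
    using assms by (auto simp: det_def permutes_in_image intro!: sum.cong prod.cong)
  ultimately show ?thesis
    using det_transpose[OF assms] by simp
qed

lemma cscalar_prod_adjoint: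
  fixes A :: "complex mat"
  assumes "A \<in> carrier_mat n m" "v \<in> carrier_vec m" "w \<in> carrier_vec n"
  shows "(A *\<^sub>v v) \<bullet>c w = v \<bullet>c (mat_adjoint A *\<^sub>v w)"
proof -
  have "(A *\<^sub>v v) \<bullet>c w = (\<Sum>i<n. \<Sum>j<m. A $$ (i, j) * v $ j * cnj (w $ i))"
    using assms by (auto simp: scalar_prod_def sum_distrib_right lessThan_atLeast0 intro!: sum.cong)
  also have "\<dots> = (\<Sum>j<m. \<Sum>i<n. A $$ (i, j) * v $ j * cnj (w $ i))"
    by (rule sum.swap)
  also have "\<dots> = v \<bullet>c (mat_adjoint A *\<^sub>v w)"
    using assms by (auto simp: scalar_prod_def sum_distrib_left lessThan_atLeast0 ac_simps intro!: sum.cong)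
  finally show ?thesis .
qed

section \<open>Unitary matrices and diagonalization of Hermitian matrices\<close>

definition unitary_mats :: "nat \<Rightarrow> complex mat set" where
  "unitary_mats n = {U \<in> carrier_mat n n. mat_adjoint U * U = 1\<^sub>m n}"

lemma unitaryD:
  assumes "U \<in> unitary_mats n"
  shows "U \<in> carrier_mat n n" "mat_adjoint U * U = 1\<^sub>m n" "U * mat_adjoint U = 1\<^sub>m n"
  using assms mat_mult_left_right_inverse[of "mat_adjoint U" n U] by (auto simp: unitary_mats_def)

text \<open>Meant for products reassociated to the right: an adjacent pair \<open>V\<close>,
  \<open>U\<close> is removed in front of the remaining factors \<open>A\<close>.\<close>

lemma mult_cancel_adjacent:
  fixes U :: "'a :: comm_ring_1 mat"
  assumes "V * U = 1\<^sub>m n" "U \<in> carrier_mat n n" "V \<in> carrier_mat n n" "A \<in> carrier_mat n m"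
  shows "V * (U * A) = A"
  using assms by (simp flip: assoc_mult_mat[of V n n U n A m])

lemma unitary_mult:
  assumes U: "U \<in> unitary_mats n" and V: "V \<in> unitary_mats n"
  shows "U * V \<in> unitary_mats n"
proof -
  note u = unitaryD[OF U] and v = unitaryD[OF V]
  have "mat_adjoint (U * V) * (U * V) = mat_adjoint V * (mat_adjoint U * (U * V))"
    using u v by (simp add: mat_adjoint_mult[of U n n V n] assoc_mult_mat[of _ n n _ n _ n])
  also have "\<dots> = 1\<^sub>m n"
    using u v by (simp add: mult_cancel_adjacent[of _ _ n _ n])
  finally show ?thesis
    using u v by (simp add: unitary_mats_def)
qed

text \<open>The three-factor form is the one in \<open>mat_fun\<close>, so a diagonalization can be
  fed directly to its description. Only the values of \<open>d\<close> below \<open>n\<close>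
  matter.\<close>

definition spec_mat :: "nat \<Rightarrow> complex mat \<Rightarrow> (nat \<Rightarrow> real) \<Rightarrow> complex mat" where
  "spec_mat n U d = U * mat_diag n (\<lambda>i. complex_of_real (d i)) * mat_adjoint U"

lemma spec_mat_carrier [simp]: "U \<in> carrier_mat n n \<Longrightarrow> spec_mat n U d \<in> carrier_mat n n"
  by (auto simp: spec_mat_def)

lemma mat_adjoint_diag [simp]:
  "mat_adjoint (mat_diag n (\<lambda>i. complex_of_real (d i))) = mat_diag n (\<lambda>i. complex_of_real (d i))"
  by (rule eq_matI) (auto simp: mat_diag_def)

lemma spec_mat_adjoint [simp]:
  assumes "U \<in> carrier_mat n n"
  shows "mat_adjoint (spec_mat n U d) = spec_mat n U d"
  using assms unfolding spec_mat_def
  by (simp add: mat_adjoint_mult[of _ n n _ n] assoc_mult_mat[of _ n n _ n _ n])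

lemma spec_mat_mult:
  assumes "U \<in> unitary_mats n"
  shows "spec_mat n U d * spec_mat n U e = spec_mat n U (\<lambda>i. d i * e i)"
proof -
  note u = unitaryD[OF assms]
  have "spec_mat n U d * spec_mat n U e =
    U * (mat_diag n (\<lambda>i. complex_of_real (d i)) * (mat_adjoint U * (U * (mat_diag n (\<lambda>i. complex_of_real (e i)) * mat_adjoint U))))"
    using u by (simp add: spec_mat_def assoc_mult_mat[of _ n n _ n _ n])
  also have "\<dots> = U * ((mat_diag n (\<lambda>i. complex_of_real (d i)) * mat_diag n (\<lambda>i. complex_of_real (e i))) * mat_adjoint U)"
    using u by (simp add: mult_cancel_adjacent[of _ _ n _ n] assoc_mult_mat[of _ n n _ n _ n] del: mat_diag_diag)
  also have "\<dots> = spec_mat n U (\<lambda>i. d i * e i)"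
    using u by (simp add: spec_mat_def assoc_mult_mat[of _ n n _ n _ n])
  finally show ?thesis .
qed

lemma spec_mat_cong: "(\<And>i. i < n \<Longrightarrow> d i = e i) \<Longrightarrow> spec_mat n U d = spec_mat n U e"
  unfolding spec_mat_def mat_diag_def
  by (rule arg_cong[where f = "\<lambda>D. U * D * mat_adjoint U"], rule eq_matI) auto

lemma eigenvalue_hermitian_real:
  fixes A :: "complex mat"
  assumes A: "A \<in> carrier_mat n n" "mat_adjoint A = A" and e: "eigenvalue A e"
  shows "Im e = 0"
proof -
  from e obtain v where v: "v \<in> carrier_vec n" "v \<noteq> 0\<^sub>v n" "A *\<^sub>v v = e \<cdot>\<^sub>v v"
    using A by (auto simp: eigenvalue_def eigenvector_def)
  have "e * (v \<bullet>c v) = (A *\<^sub>v v) \<bullet>c v"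
    using v by simp
  also have "\<dots> = v \<bullet>c (A *\<^sub>v v)"
    using cscalar_prod_adjoint[OF A(1) v(1) v(1)] A by simp
  also have "\<dots> = cnj e * (v \<bullet>c v)"
    using v by (simp add: conjugate_smult_vec)
  finally show ?thesis
    using conjugate_square_eq_0_vec[OF v(1)] v(2) by (metis mult_right_cancel cnj.simps(2) equal_neg_zero)
qed

text \<open>Deflation for the spectral theorem. Gram-Schmidt keeps \<open>v\<close> as the first
  vector and makes the family orthogonal but not normalized; dividing by the norms gives the columns
  of \<open>W\<close>, hence the factor \<open>c\<close>.\<close>

lemma unitary_first_col:
  fixes v :: "complex vec"
  assumes v: "v \<in> carrier_vec n" "v \<noteq> 0\<^sub>v n"
  obtains W c where "W \<in> unitary_mats n" "col W 0 = c \<cdot>\<^sub>v v" "c \<noteq> 0" "0 < n"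
proof -
  interpret cof_vec_space n "TYPE(complex)" .
  define b where "b = basis_completion v"
  have n: "0 < n"
    using v by (cases n) auto
  from basis_completion[OF v, folded b_def]
  have b: "distinct b" "\<not> lin_dep (set b)" "set b \<subseteq> carrier_vec n" "hd b = v" "length b = n"
    by auto
  define ws where "ws = gram_schmidt n b"
  from gram_schmidt_result[OF b(3,1,2) ws_def]
  have ws: "set ws \<subseteq> carrier_vec n" "corthogonal ws" "length ws = n"
    by (auto simp: b)
  obtain vs where "b = v # vs"
    using b n by (cases b) auto
  then have "hd ws = v"
    unfolding ws_def using gram_schmidt_hd[OF v(1)] by simp
  then have ws0: "ws ! 0 = v"
    using ws n by (cases ws) auto
  have car: "ws ! i \<in> carrier_vec n" if "i < n" for i
    using ws that by auto
  define c where "c i = complex_of_real (1 / sqrt (Re (ws ! i \<bullet>c ws ! i)))" for i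
  have pos: "Re (ws ! i \<bullet>c ws ! i) > 0" "Im (ws ! i \<bullet>c ws ! i) = 0" if i: "i < n" for i
  proof -
    have "ws ! i \<bullet>c ws ! i \<noteq> 0"
      using corthogonalD[OF ws(2)] i ws by auto
    then have "0 < ws ! i \<bullet>c ws ! i"
      using conjugate_square_ge_0_vec[of "ws ! i"] by (simp add: less_le)
    then show "Re (ws ! i \<bullet>c ws ! i) > 0" "Im (ws ! i \<bullet>c ws ! i) = 0"
      by (auto simp: less_complex_def)
  qed
  have cc: "cnj (c i) = c i" for i
    by (simp add: c_def)
  define W where "W = mat n n (\<lambda>(i, j). c j * ws ! j $ i)"
  have "W \<in> unitary_mats n"
  proof -
    have "(mat_adjoint W * W) $$ (i, j) = 1\<^sub>m n $$ (i, j)" if ij: "i < n" "j < n" for i j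
    proof -
      have "(mat_adjoint W * W) $$ (i, j) = c j * c i * (ws ! j \<bullet>c ws ! i)"
        using ij car[of i] car[of j] unfolding W_def
        by (auto simp: scalar_prod_def sum_distrib_left cc ac_simps intro!: sum.cong)
      also have "\<dots> = (if i = j then 1 else 0)"
      proof (cases "i = j")
        case True
        have "ws ! j \<bullet>c ws ! j = complex_of_real (Re (ws ! j \<bullet>c ws ! j))"
          using pos[OF ij(2)] by (simp add: complex_eq_iff)
        then have "c j * c j * (ws ! j \<bullet>c ws ! j) = complex_of_real (1 / sqrt (Re (ws ! j \<bullet>c ws ! j)) * (1 / sqrt (Re (ws ! j \<bullet>c ws ! j))) * Re (ws ! j \<bullet>c ws ! j))"
          unfolding c_def by (metis of_real_mult)
        also have "\<dots> = 1"
          using pos[OF ij(2)] by (simp add: field_simps)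
        finally show ?thesis
          using True by simp
      next
        case False
        then show ?thesis
          using corthogonalD[OF ws(2)] ij ws by auto
      qed
      finally show ?thesis
        using ij by simp
    qed
    then have "mat_adjoint W * W = 1\<^sub>m n"
      by (intro eq_matI) (auto simp: W_def)
    then show ?thesis
      by (simp add: unitary_mats_def W_def)
  qed
  moreover have "col W 0 = c 0 \<cdot>\<^sub>v v"
    using n v ws0 by (intro eq_vecI) (auto simp: W_def)
  moreover have "c 0 \<noteq> 0"
    using pos[OF n] by (simp add: c_def)
  ultimately show thesis
    using that n by blast
qed

lemma four_block_adjoint:
  fixes A :: "complex mat"
  assumes "A \<in> carrier_mat a b" "B \<in> carrier_mat a d" "C \<in> carrier_mat c b" "D \<in> carrier_mat c d"
  shows "mat_adjoint (four_block_mat A B C D) =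
    four_block_mat (mat_adjoint A) (mat_adjoint C) (mat_adjoint B) (mat_adjoint D)"
  using assms by (intro eq_matI) auto

lemma block_diag_mult:
  fixes A C :: "'a :: comm_ring_1 mat"
  assumes "A \<in> carrier_mat k k" "B \<in> carrier_mat m m" "C \<in> carrier_mat k k" "D \<in> carrier_mat m m"
  shows "four_block_mat A (0\<^sub>m k m) (0\<^sub>m m k) B * four_block_mat C (0\<^sub>m k m) (0\<^sub>m m k) D =
    four_block_mat (A * C) (0\<^sub>m k m) (0\<^sub>m m k) (B * D)"
  using assms by (subst mult_four_block_mat[of _ k k _ m _ m _ _ k _ m]) auto

text \<open>The induction runs over the list \<open>es\<close> and splits off its head, so the
  diagonal appears in exactly the order of \<open>es\<close>; a sorted list of roots later yields a
  sorted diagonal.\<close>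

lemma hermitian_diagonalization:
  fixes A :: "complex mat"
  assumes "A \<in> carrier_mat n n" "mat_adjoint A = A"
    and "char_poly A = (\<Prod>e\<leftarrow>es. [:- complex_of_real e, 1:])"
  shows "\<exists>U \<in> unitary_mats n. A = spec_mat n U (\<lambda>i. es ! i)"
  using assms
proof (induction es arbitrary: n A)
  case Nil
  then have "n = 0"
    using degree_monic_char_poly[of A n] by auto
  with Nil have "1\<^sub>m n \<in> unitary_mats n" "A = spec_mat n (1\<^sub>m n) (\<lambda>i. [] ! i)"
    by (auto simp: unitary_mats_def spec_mat_def intro!: eq_matI)
  then show ?case ..
next
  case (Cons e es)
  note A = Cons.prems(1,2)
  have "eigenvalue A (complex_of_real e)"
    unfolding eigenvalue_root_char_poly[OF A(1)] Cons.prems(3) by simp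
  then obtain v where v: "v \<in> carrier_vec n" "v \<noteq> 0\<^sub>v n" "A *\<^sub>v v = complex_of_real e \<cdot>\<^sub>v v"
    using A by (auto simp: eigenvalue_def eigenvector_def)
  obtain W c where W: "W \<in> unitary_mats n" "col W 0 = c \<cdot>\<^sub>v v" and n: "0 < n"
    using unitary_first_col[OF v(1,2)] by metis
  note w = unitaryD[OF W(1)]
  obtain m where m: "n = Suc m"
    using n by (cases n) auto
  \<comment> \<open>The first column of \<open>W\<close> is an eigenvector, so the first column of
    \<open>H\<close> is \<open>e\<close> times a unit vector. As \<open>H\<close> is Hermitian the
    same holds for its first row, and \<open>H\<close> splits into blocks.\<close>
  define H where "H = mat_adjoint W * A * W"
  have H: "H \<in> carrier_mat n n"
    using w A by (auto simp: H_def)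
  have H_adj: "mat_adjoint H = H"
    using w A by (simp add: H_def mat_adjoint_mult[of _ n n _ n] assoc_mult_mat[of _ n n _ n _ n])
  have AW: "A = W * H * mat_adjoint W"
  proof -
    have "W * H * mat_adjoint W = W * (mat_adjoint W * (A * (W * mat_adjoint W)))"
      using w A by (simp add: H_def assoc_mult_mat[of _ n n _ n _ n])
    also have "\<dots> = A"
      using w A by (simp add: mult_cancel_adjacent[of _ _ n _ n])
    finally show ?thesis by simp
  qed
  have "col H 0 = mat_adjoint W *\<^sub>v (A *\<^sub>v col W 0)"
  proof -
    have "col H 0 = (mat_adjoint W * A) *\<^sub>v col W 0"
      unfolding H_def using w A n by (intro col_mult2[of _ n n _ n]) auto
    also have "\<dots> = mat_adjoint W *\<^sub>v (A *\<^sub>v col W 0)"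
      using w A n by (intro assoc_mult_mat_vec[of _ n n _ n]) (auto simp: carrier_vecI)
    finally show ?thesis .
  qed
  also have "A *\<^sub>v col W 0 = complex_of_real e \<cdot>\<^sub>v col W 0"
    unfolding W(2) mult_mat_vec[OF A(1) v(1)] v(3) smult_smult_assoc by (simp only: mult.commute)
  also have "mat_adjoint W *\<^sub>v (complex_of_real e \<cdot>\<^sub>v col W 0) = complex_of_real e \<cdot>\<^sub>v col (mat_adjoint W * W) 0"
    using w n by (subst mult_mat_vec[of _ n n]) (auto simp: carrier_vecI simp flip: col_mult2[of _ n n _ n])
  finally have "col H 0 = complex_of_real e \<cdot>\<^sub>v unit_vec n 0"
    using w n by simp
  note col0 = this
  have col: "H $$ (i, 0) = (if i = 0 then complex_of_real e else 0)" if "i < n" for i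
  proof -
    have "col H 0 $ i = (complex_of_real e \<cdot>\<^sub>v unit_vec n 0) $ i"
      by (simp only: col0)
    then show ?thesis
      using H n that by simp
  qed
  have row: "H $$ (0, i) = (if i = 0 then complex_of_real e else 0)" if "i < n" for i
  proof -
    have "mat_adjoint H $$ (0, i) = cnj (H $$ (i, 0))"
      using H n that by simp
    then show ?thesis
      using col[OF that] H_adj by simp
  qed
  define H3 where "H3 = mat m m (\<lambda>(i, j). H $$ (Suc i, Suc j))"
  define E where "E = mat 1 1 (\<lambda>_. complex_of_real e)"
  have H3: "H3 \<in> carrier_mat m m" and E: "E \<in> carrier_mat 1 1"
    by (auto simp: H3_def E_def)
  have blk: "H = four_block_mat E (0\<^sub>m 1 m) (0\<^sub>m m 1) H3"
    by (rule eq_matI) (use H m in \<open>auto simp: H3_def E_def col row\<close>)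
  have H3_adj: "mat_adjoint H3 = H3"
  proof (rule eq_matI)
    fix i j assume "i < dim_row H3" "j < dim_col H3"
    then have ij: "i < m" "j < m"
      by (auto simp: H3_def)
    then have "mat_adjoint H $$ (Suc i, Suc j) = cnj (H $$ (Suc j, Suc i))"
      using H m by simp
    then show "mat_adjoint H3 $$ (i, j) = H3 $$ (i, j)"
      using ij H_adj by (simp add: H3_def)
  qed (use H3 in auto)
  have "similar_mat H A"
    unfolding similar_mat_def using w A H H_def
    by (intro exI[of _ "mat_adjoint W"] exI[of _ W] similar_mat_witI[of _ _ n]) auto
  then have "char_poly A = char_poly H"
    by (simp add: char_poly_similar)
  also have "\<dots> = char_poly E * char_poly H3"
    unfolding blk by (rule char_poly_four_block_zeros_col[OF _ _ H3]) (auto simp: E_def)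
  also have "char_poly E = [:- complex_of_real e, 1:]"
    by (simp add: E_def char_poly_defs det_def sign_def)
  finally have "[:- complex_of_real e, 1:] * char_poly H3 =
      [:- complex_of_real e, 1:] * (\<Prod>e\<leftarrow>es. [:- complex_of_real e, 1:])"
    using Cons.prems(3) by simp
  then have "char_poly H3 = (\<Prod>e\<leftarrow>es. [:- complex_of_real e, 1:])"
    by (metis mult_cancel_left pCons_eq_0_iff zero_neq_one)
  from Cons.IH[OF H3 H3_adj this] obtain V
    where V: "V \<in> unitary_mats m" "H3 = spec_mat m V (\<lambda>i. es ! i)" by blast
  note vv = unitaryD[OF V(1)]
  define V' where "V' = four_block_mat (1\<^sub>m 1) (0\<^sub>m 1 m) (0\<^sub>m m 1) V"
  have V'c: "V' \<in> carrier_mat n n"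
    using vv m by (auto simp: V'_def)
  have V'a: "mat_adjoint V' = four_block_mat (1\<^sub>m 1) (0\<^sub>m 1 m) (0\<^sub>m m 1) (mat_adjoint V)"
  proof -
    have "mat_adjoint (0\<^sub>m 1 m :: complex mat) = 0\<^sub>m m 1" "mat_adjoint (0\<^sub>m m 1 :: complex mat) = 0\<^sub>m 1 m"
      by (auto intro!: eq_matI)
    then show ?thesis
      unfolding V'_def using vv by (subst four_block_adjoint[of _ 1 1 _ m _ m]) auto
  qed
  have "mat_adjoint V' * V' = 1\<^sub>m n"
    unfolding V'a unfolding V'_def using vv m
    by (subst mult_four_block_mat[of _ 1 1 _ m _ m _ _ 1 _ m]) auto
  then have V'u: "V' \<in> unitary_mats n"
    using V'c by (simp add: unitary_mats_def)
  have D: "mat_diag n (\<lambda>i. complex_of_real ((e # es) ! i)) =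
      four_block_mat E (0\<^sub>m 1 m) (0\<^sub>m m 1) (mat_diag m (\<lambda>i. complex_of_real (es ! i)))"
    using m by (intro eq_matI) (auto simp: mat_diag_def E_def nth_Cons split: nat.splits)
  have "spec_mat n V' (\<lambda>i. (e # es) ! i) = H"
    unfolding spec_mat_def D V'a blk V(2)
    unfolding V'_def using vv E by (simp add: block_diag_mult)
  moreover have "spec_mat n (W * V') d = W * spec_mat n V' d * mat_adjoint W" for d
    using w V'c by (simp add: spec_mat_def mat_adjoint_mult[of _ n n _ n] assoc_mult_mat[of _ n n _ n _ n])
  ultimately have "A = spec_mat n (W * V') (\<lambda>i. (e # es) ! i)"
    by (simp only: AW[symmetric])
  then show ?case
    using unitary_mult[OF W(1) V'u] by (rule bexI)
qed

section \<open>Functional calculus and eigenvalue products\<close>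

text \<open>\<open>W\<close> intertwines the two diagonals, so \<open>W $$ (i, j) = 0\<close> unless
  \<open>d j = e i\<close>; where an entry survives, \<open>f\<close> takes the same value on both
  sides. This is the uniqueness behind \<open>mat_fun\<close>.\<close>

lemma spec_mat_unique:
  assumes U: "U \<in> unitary_mats n" and V: "V \<in> unitary_mats n"
    and eq: "spec_mat n U d = spec_mat n V e"
  shows "spec_mat n U (\<lambda>i. f (d i)) = spec_mat n V (\<lambda>i. f (e i))"
proof -
  note u = unitaryD[OF U] and v = unitaryD[OF V]
  define W where "W = mat_adjoint V * U"
  have W: "W \<in> carrier_mat n n"
    using u v by (simp add: W_def)
  let ?D = "\<lambda>d. mat_diag n (\<lambda>i. complex_of_real (d i))"
  have 1: "W * ?D d = mat_adjoint V * (spec_mat n U d * U)"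
    using u v by (simp add: W_def spec_mat_def assoc_mult_mat[of _ n n _ n _ n] right_mult_one_mat[of _ n n])
  have 2: "?D e * W = mat_adjoint V * (spec_mat n V e * U)"
    using u v by (simp add: W_def spec_mat_def assoc_mult_mat[of _ n n _ n _ n] mult_cancel_adjacent[of _ _ n _ n])
  have "W $$ (i, j) * d j = e i * W $$ (i, j)" if "i < n" "j < n" for i j
  proof -
    have "(W * ?D d) $$ (i, j) = (?D e * W) $$ (i, j)"
      using 1 2 eq by simp
    then show ?thesis
      using that W by (simp only: mat_diag_mult_left[of _ n n] mat_diag_mult_right[of _ n n] index_mat split)
  qed
  then have "W $$ (i, j) * f (d j) = f (e i) * W $$ (i, j)" if "i < n" "j < n" for i j
    using that by (cases "W $$ (i, j) = 0") (force simp: mult.commute)+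
  then have 3: "W * ?D (\<lambda>i. f (d i)) = ?D (\<lambda>i. f (e i)) * W"
    using W by (intro eq_matI) (auto simp: mat_diag_mult_left[of _ n n] mat_diag_mult_right[of _ n n])
  have "spec_mat n U (\<lambda>i. f (d i)) = V * (W * ?D (\<lambda>i. f (d i))) * mat_adjoint U"
  proof -
    have "V * W = U"
      using u v by (simp add: W_def mult_cancel_adjacent[of _ _ n _ n])
    then show ?thesis
      using u v W by (simp add: spec_mat_def flip: assoc_mult_mat[of _ n n _ n _ n])
  qed
  also have "\<dots> = spec_mat n V (\<lambda>i. f (e i))"
    unfolding 3 using u v W by (simp add: W_def spec_mat_def assoc_mult_mat[of _ n n _ n _ n])
  finally show ?thesis .
qed

lemma mat_fun_spec:
  assumes U: "U \<in> unitary_mats n"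
  shows "mat_fun f (spec_mat n U d) = spec_mat n U (\<lambda>i. f (d i))"
proof -
  have dim: "dim_row (spec_mat n U d) = n"
    using unitaryD(1)[OF U] by (simp add: spec_mat_def)
  show ?thesis
    unfolding mat_fun_def dim
  proof (rule the_equality)
    show "\<exists>V e. V \<in> carrier_mat n n \<and> mat_adjoint V * V = 1\<^sub>m n \<and>
       spec_mat n U d = V * mat_diag n (\<lambda>i. complex_of_real (e i)) * mat_adjoint V \<and>
       spec_mat n U (\<lambda>i. f (d i)) = V * mat_diag n (\<lambda>i. complex_of_real (f (e i))) * mat_adjoint V"
      using unitaryD[OF U] by (intro exI[of _ U] exI[of _ d]) (simp add: spec_mat_def)
  next
    fix X
    assume "\<exists>V e. V \<in> carrier_mat n n \<and> mat_adjoint V * V = 1\<^sub>m n \<and>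
       spec_mat n U d = V * mat_diag n (\<lambda>i. complex_of_real (e i)) * mat_adjoint V \<and>
       X = V * mat_diag n (\<lambda>i. complex_of_real (f (e i))) * mat_adjoint V"
    then obtain V e where V: "V \<in> unitary_mats n" and "spec_mat n U d = spec_mat n V e"
      and X: "X = spec_mat n V (\<lambda>i. f (e i))"
      unfolding spec_mat_def unitary_mats_def by blast
    from spec_mat_unique[OF U V this(2)] X show "X = spec_mat n U (\<lambda>i. f (d i))"
      by simp
  qed
qed

text \<open>Since \<open>inverse 0 = 0\<close> and \<open>0 powr r = 0\<close>, both branches of
  \<open>mat_rpow\<close> vanish on the kernel, so one formula covers every real exponent.\<close>

lemma mat_rpow_spec:
  assumes "U \<in> unitary_mats n" and d: "\<And>i. i < n \<Longrightarrow> 0 \<le> d i"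
  shows "mat_rpow (spec_mat n U d) r = spec_mat n U (\<lambda>i. d i powr r)"
proof -
  have "inverse (d i) powr (- r) = d i powr r" if "i < n" for i
    using d[OF that] by (cases "d i = 0") (auto simp: powr_minus inverse_powr)
  then show ?thesis
    using assms by (auto simp: mat_rpow_def gen_inverse_def mat_fun_spec intro: spec_mat_cong)
qed

lemma spec_mat_index:
  assumes "U \<in> carrier_mat n n" "i < n" "j < n"
  shows "spec_mat n U d $$ (i, j) = (\<Sum>l<n. complex_of_real (d l) * (U $$ (i, l) * cnj (U $$ (j, l))))"
  using assms by (simp add: spec_mat_def mat_diag_mult_right[of _ n n] scalar_prod_def lessThan_atLeast0 ac_simps)

lemma spec_mat_one:
  assumes "U \<in> unitary_mats n"
  shows "spec_mat n U (\<lambda>_. 1) = 1\<^sub>m n"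
  using unitaryD[OF assms] by (simp add: spec_mat_def)

section \<open>Positive (semi)definite matrices and congruences\<close>

lemma adjoint_conj_index:
  fixes A M :: "complex mat"
  assumes "A \<in> carrier_mat n n" "M \<in> carrier_mat n m" "i < m" "j < m"
  shows "(mat_adjoint M * A * M) $$ (i, j) = (A *\<^sub>v col M j) \<bullet>c col M i"
proof -
  have "mat_adjoint M * A * M = mat_adjoint M * (A * M)"
    using assms by (intro assoc_mult_mat) auto
  also have "(mat_adjoint M * (A * M)) $$ (i, j) = row (mat_adjoint M) i \<bullet> col (A * M) j"
    using assms by simp
  also have "row (mat_adjoint M) i = conjugate (col M i)"
    using assms by (intro eq_vecI) auto
  also have "col (A * M) j = A *\<^sub>v col M j"
    using assms by (intro col_mult2) auto
  finally show ?thesis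
    using assms by (subst comm_scalar_prod[of _ n]) (auto simp: carrier_vecI)
qed

lemma adjoint_congruence:
  fixes A M :: "complex mat"
  assumes "A \<in> carrier_mat n n" "mat_adjoint A = A" "M \<in> carrier_mat n m"
  shows "mat_adjoint (mat_adjoint M * A * M) = mat_adjoint M * A * M"
proof -
  have c: "mat_adjoint M * A \<in> carrier_mat m n"
    using assms by (intro mult_carrier_mat) auto
  have "mat_adjoint (mat_adjoint M * A * M) = mat_adjoint M * mat_adjoint (mat_adjoint M * A)"
    using mat_adjoint_mult[OF c assms(3)] .
  also have "mat_adjoint (mat_adjoint M * A) = A * M"
    using mat_adjoint_mult[of "mat_adjoint M" m n A n] assms by simp
  also have "mat_adjoint M * (A * M) = mat_adjoint M * A * M"
    using assms by (intro assoc_mult_mat[symmetric]) auto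
  finally show ?thesis .
qed

lemma congruence_form:
  fixes A M :: "complex mat"
  assumes "A \<in> carrier_mat n n" "M \<in> carrier_mat n m" "v \<in> carrier_vec m"
  shows "((mat_adjoint M * A * M) *\<^sub>v v) \<bullet>c v = (A *\<^sub>v (M *\<^sub>v v)) \<bullet>c (M *\<^sub>v v)"
proof -
  have "(mat_adjoint M * A * M) *\<^sub>v v = mat_adjoint M *\<^sub>v (A *\<^sub>v (M *\<^sub>v v))"
  proof -
    have "mat_adjoint M * A \<in> carrier_mat m n"
      using assms by (intro mult_carrier_mat) auto
    then have "(mat_adjoint M * A * M) *\<^sub>v v = (mat_adjoint M * A) *\<^sub>v (M *\<^sub>v v)"
      using assms by (intro assoc_mult_mat_vec) auto
    also have "\<dots> = mat_adjoint M *\<^sub>v (A *\<^sub>v (M *\<^sub>v v))"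
      using assms by (intro assoc_mult_mat_vec) auto
    finally show ?thesis .
  qed
  moreover have "A *\<^sub>v (M *\<^sub>v v) \<in> carrier_vec n"
    using assms by (intro mult_mat_vec_carrier) auto
  ultimately show ?thesis
    using cscalar_prod_adjoint[of "mat_adjoint M" m n "A *\<^sub>v (M *\<^sub>v v)" v] assms by simp
qed

lemma psd_congruence:
  assumes "A \<in> psd_mats n" "M \<in> carrier_mat n m"
  shows "mat_adjoint M * A * M \<in> psd_mats m"
proof -
  have A: "A \<in> carrier_mat n n" "mat_adjoint A = A"
    using assms by (auto simp: psd_mats_def)
  have "0 \<le> ((mat_adjoint M * A * M) *\<^sub>v v) \<bullet>c v" if v: "v \<in> carrier_vec m" for v
  proof -
    have "M *\<^sub>v v \<in> carrier_vec n"
      using v assms by (intro mult_mat_vec_carrier) auto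
    then show ?thesis
      unfolding congruence_form[OF A(1) assms(2) v] using assms by (auto simp: psd_mats_def)
  qed
  moreover have "mat_adjoint M * A * M \<in> carrier_mat m m"
    using A assms by (intro mult_carrier_mat) auto
  ultimately show ?thesis
    using adjoint_congruence[OF A assms(2)] unfolding psd_mats_def by blast
qed

lemma psd_matsD:
  assumes "A \<in> psd_mats n"
  shows "A \<in> carrier_mat n n" "mat_adjoint A = A" "dim_row A = n" "dim_col A = n"
  using assms by (auto simp: psd_mats_def)

lemma one_psd: "1\<^sub>m n \<in> psd_mats n"
  unfolding psd_mats_def using conjugate_square_ge_0_vec by auto

lemma adjoint_self_psd:
  assumes "M \<in> carrier_mat n m"
  shows "mat_adjoint M * M \<in> psd_mats m"
proof -
  have "mat_adjoint M * 1\<^sub>m n * M = mat_adjoint M * M"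
    using assms by simp
  then show ?thesis
    using psd_congruence[OF one_psd assms] by simp
qed

lemma psd_congruence_hermitian:
  assumes "A \<in> psd_mats n" "H \<in> psd_mats n"
  shows "H * A * H \<in> psd_mats n"
  using psd_congruence[OF assms(1) psd_matsD(1)[OF assms(2)]] psd_matsD(2)[OF assms(2)] by simp

lemma spec_mat_psd:
  assumes U: "U \<in> unitary_mats n" and d: "\<And>i. i < n \<Longrightarrow> 0 \<le> d i"
  shows "spec_mat n U d \<in> psd_mats n"
proof -
  note u = unitaryD[OF U]
  define S where "S = spec_mat n U (\<lambda>i. sqrt (d i))"
  have S: "S \<in> carrier_mat n n" "mat_adjoint S = S"
    using u by (simp_all add: S_def)
  have "S * S = spec_mat n U d"
    unfolding S_def spec_mat_mult[OF U] by (rule spec_mat_cong) (use d in simp)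
  then show ?thesis
    using adjoint_self_psd[OF S(1)] S(2) by simp
qed

lemma pd_subset_psd: "pd_mats n \<subseteq> psd_mats n"
proof
  fix A assume A: "A \<in> pd_mats n"
  then have c: "A \<in> carrier_mat n n"
    by (simp add: pd_mats_def)
  have "0 \<le> (A *\<^sub>v v) \<bullet>c v" if "v \<in> carrier_vec n" for v
  proof (cases "v = 0\<^sub>v n")
    case True
    have "A *\<^sub>v v \<in> carrier_vec n"
      using c that by (rule mult_mat_vec_carrier)
    then show ?thesis
      using True by (simp add: scalar_prod_def)
  next
    case False
    then show ?thesis
      using A that by (auto simp: pd_mats_def less_imp_le)
  qed
  then show "A \<in> psd_mats n"
    using A by (auto simp: pd_mats_def psd_mats_def)
qed

text \<open>Strictness comes from \<open>T\<close>, a left inverse of the square root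
  \<open>S\<close>: it shows that \<open>S\<close> maps nonzero vectors to nonzero vectors.\<close>

lemma spec_mat_pd:
  assumes U: "U \<in> unitary_mats n" and d: "\<And>i. i < n \<Longrightarrow> 0 < d i"
  shows "spec_mat n U d \<in> pd_mats n"
proof -
  note u = unitaryD[OF U]
  define S where "S = spec_mat n U (\<lambda>i. sqrt (d i))"
  define T where "T = spec_mat n U (\<lambda>i. 1 / sqrt (d i))"
  have S: "S \<in> carrier_mat n n" "mat_adjoint S = S" and T: "T \<in> carrier_mat n n"
    using u by (simp_all add: S_def T_def)
  have SS: "S * S = spec_mat n U d"
    unfolding S_def spec_mat_mult[OF U] by (rule spec_mat_cong) (use d in \<open>simp add: less_imp_le\<close>)
  have "T * S = spec_mat n U (\<lambda>_. 1)"
    unfolding S_def T_def spec_mat_mult[OF U] by (rule spec_mat_cong) (use d in force)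
  then have TS: "T * S = 1\<^sub>m n"
    using spec_mat_one[OF U] by simp
  have "0 < (spec_mat n U d *\<^sub>v v) \<bullet>c v" if v: "v \<in> carrier_vec n" "v \<noteq> 0\<^sub>v n" for v
  proof -
    have Sv: "S *\<^sub>v v \<in> carrier_vec n"
      using S v by (intro mult_mat_vec_carrier) auto
    have "T *\<^sub>v (S *\<^sub>v v) = v"
      using TS S T v by (metis assoc_mult_mat_vec one_mult_mat_vec)
    moreover have "T *\<^sub>v 0\<^sub>v n = 0\<^sub>v n"
      using T by (intro eq_vecI) auto
    ultimately have "S *\<^sub>v v \<noteq> 0\<^sub>v n"
      using v by auto
    then have "0 < (S *\<^sub>v v) \<bullet>c (S *\<^sub>v v)"
      using conjugate_square_greater_0_vec[OF Sv] by blast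
    also have "\<dots> = (spec_mat n U d *\<^sub>v v) \<bullet>c v"
      using congruence_form[of "1\<^sub>m n" n S n v] S v Sv SS by simp
    finally show ?thesis .
  qed
  then show ?thesis
    using u by (auto simp: pd_mats_def)
qed

section \<open>Ordered eigenvalue lists\<close>

lemma sorted_wrt_ge_unique:
  fixes xs ys :: "'a :: linorder list"
  assumes "sorted_wrt (\<ge>) xs" "sorted_wrt (\<ge>) ys" "mset xs = mset ys"
  shows "xs = ys"
proof -
  have "sorted (rev xs)" "sorted (rev ys)"
    using assms by (simp_all add: sorted_wrt_rev)
  then have "rev xs = rev ys"
    using assms(3) by (metis mset_rev properties_for_sort)
  then show ?thesis by simp
qed

text \<open>The multiset of roots recovers the list up to order, and \<open>Re\<close> undoes the
  embedding into the complex numbers. Together with sortedness this resolves the description in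
  \<open>eigvals_desc\<close>.\<close>

lemma mset_eq_of_linear_factors:
  fixes xs ys :: "real list"
  assumes "(\<Prod>x\<leftarrow>xs. [:- complex_of_real x, 1:]) = (\<Prod>x\<leftarrow>ys. [:- complex_of_real x, 1:])"
  shows "mset xs = mset ys"
proof -
  have "proots (\<Prod>x\<leftarrow>zs. [:- complex_of_real x, 1:]) = image_mset complex_of_real (mset zs)" for zs
  proof (induction zs)
    case (Cons z zs)
    have "(\<Prod>x\<leftarrow>zs. [:- complex_of_real x, 1:]) \<noteq> 0"
      by (auto simp: prod_list_zero_iff)
    then show ?case
      using Cons proots_mult[of "[:- complex_of_real z, 1:]" "\<Prod>x\<leftarrow>zs. [:- complex_of_real x, 1:]"]
      by (simp del: mult_pCons_left)
  qed simp
  then have "image_mset complex_of_real (mset xs) = image_mset complex_of_real (mset ys)"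
    using assms by metis
  then have "image_mset Re (image_mset complex_of_real (mset xs)) = image_mset Re (image_mset complex_of_real (mset ys))"
    by simp
  then show ?thesis
    by (simp add: multiset.map_comp comp_def)
qed

lemma char_poly_spec:
  assumes U: "U \<in> unitary_mats n"
  shows "char_poly (spec_mat n U d) = (\<Prod>x\<leftarrow>map d [0..<n]. [:- complex_of_real x, 1:])"
proof -
  note u = unitaryD[OF U]
  let ?D = "mat_diag n (\<lambda>i. complex_of_real (d i))"
  have "similar_mat (spec_mat n U d) ?D"
    unfolding similar_mat_def
    by (intro exI[of _ U] exI[of _ "mat_adjoint U"] similar_mat_witI[of _ _ n])
      (use u in \<open>auto simp: spec_mat_def\<close>)
  then have "char_poly (spec_mat n U d) = char_poly ?D"
    by (rule char_poly_similar)
  also have "\<dots> = (\<Prod>a\<leftarrow>diag_mat ?D. [:- a, 1:])"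
    by (rule char_poly_upper_triangular[of _ n]) (auto simp: mat_diag_def)
  also have "diag_mat ?D = map (\<lambda>i. complex_of_real (d i)) [0..<n]"
    by (auto simp: diag_mat_def mat_diag_def)
  finally show ?thesis
    by (simp add: comp_def)
qed

lemma eigvals_desc_spec:
  assumes U: "U \<in> unitary_mats n" and d: "\<And>i j. i \<le> j \<Longrightarrow> j < n \<Longrightarrow> d j \<le> d i"
  shows "eigvals_desc (spec_mat n U d) = map d [0..<n]"
proof -
  have s: "sorted_wrt (\<ge>) (map d [0..<n])"
    by (auto simp: sorted_wrt_iff_nth_less intro: d)
  show ?thesis
    unfolding eigvals_desc_def char_poly_spec[OF U]
    by (rule the_equality) (use s sorted_wrt_ge_unique mset_eq_of_linear_factors in blast)+
qed

text \<open>The order is obtained by passing the sorted list of roots to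
  \<open>hermitian_diagonalization\<close>; it allows products of the largest eigenvalues to be read
  off as initial products of \<open>d\<close>.\<close>

lemma psd_spectral:
  assumes A: "A \<in> psd_mats n"
  obtains U d where "U \<in> unitary_mats n" "A = spec_mat n U d"
    "\<And>i. i < n \<Longrightarrow> 0 \<le> d i" "\<And>i j. i \<le> j \<Longrightarrow> j < n \<Longrightarrow> d j \<le> d i"
proof -
  note a = psd_matsD[OF A]
  obtain as where as: "char_poly A = (\<Prod>a\<leftarrow>as. [:- a, 1:])" "length as = n"
    using char_poly_factorized[OF a(1)] by blast
  have real: "complex_of_real (Re z) = z" if "z \<in> set as" for z
  proof -
    have "poly (char_poly A) z = 0"
      unfolding as(1) using that by (auto simp: poly_prod_list prod_list_zero_iff)
    then have "eigenvalue A z"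
      using eigenvalue_root_char_poly[OF a(1)] by blast
    then show ?thesis
      using eigenvalue_hermitian_real[OF a(1,2)] by (simp add: complex_eq_iff)
  qed
  define es where "es = rev (sort (map Re as))"
  have len: "length es = n"
    by (simp add: es_def as)
  have "(\<Prod>e\<leftarrow>es. [:- complex_of_real e, 1:]) = (\<Prod>e\<leftarrow>map Re as. [:- complex_of_real e, 1:])"
    unfolding es_def by (simp flip: prod_mset_prod_list add: multiset.map_comp comp_def)
  also have "map (\<lambda>e. [:- complex_of_real e, 1:]) (map Re as) = map (\<lambda>a. [:- a, 1:]) as"
    using real by auto
  finally have cp: "char_poly A = (\<Prod>e\<leftarrow>es. [:- complex_of_real e, 1:])"
    using as by simp
  from hermitian_diagonalization[OF a(1,2) this]
  obtain U where U: "U \<in> unitary_mats n" and AU: "A = spec_mat n U (\<lambda>i. es ! i)" by blast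
  note u = unitaryD[OF U]
  have "0 \<le> es ! i" if i: "i < n" for i
  proof -
    have "mat_adjoint U * A * U = mat_diag n (\<lambda>i. complex_of_real (es ! i))"
      using u by (simp add: AU spec_mat_def assoc_mult_mat[of _ n n _ n _ n] mult_cancel_adjacent[of _ _ n _ n] right_mult_one_mat[of _ n n])
    then have "(A *\<^sub>v col U i) \<bullet>c col U i = complex_of_real (es ! i)"
      using adjoint_conj_index[OF a(1) u(1) i i] i by (simp add: mat_diag_def)
    moreover have "0 \<le> (A *\<^sub>v col U i) \<bullet>c col U i"
      using A u(1) i by (auto simp: psd_mats_def intro!: carrier_vecI)
    ultimately show ?thesis
      by (simp add: less_eq_complex_def)
  qed
  moreover have "es ! j \<le> es ! i" if "i \<le> j" "j < n" for i j
  proof -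
    have "sorted_wrt (\<ge>) es"
      unfolding es_def by (simp add: sorted_wrt_rev)
    then show ?thesis
      using that len by (cases "i = j") (auto simp: sorted_wrt_iff_nth_less)
  qed
  ultimately show thesis
    using that[OF U AU] by blast
qed

section \<open>Real powers and products of the largest eigenvalues\<close>

lemma mat_rpow_psd:
  assumes "A \<in> psd_mats n"
  shows "mat_rpow A r \<in> psd_mats n"
  using assms by (elim psd_spectral) (auto simp: mat_rpow_spec intro!: spec_mat_psd)

text \<open>Valid for singular \<open>A\<close> and exponents of either sign, because
  \<open>powr_add\<close> also holds at base 0. When \<open>r + s = 0\<close> the product is the
  support projection.\<close>

lemma mat_rpow_add:
  assumes "A \<in> psd_mats n"
  shows "mat_rpow A r * mat_rpow A s = mat_rpow A (r + s)"
  using assms by (elim psd_spectral) (simp add: mat_rpow_spec spec_mat_mult powr_add)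

lemma mat_rpow_rpow:
  assumes "A \<in> psd_mats n"
  shows "mat_rpow (mat_rpow A r) s = mat_rpow A (r * s)"
  using assms by (elim psd_spectral) (simp add: mat_rpow_spec powr_powr)

lemma mat_rpow_one:
  assumes "A \<in> psd_mats n"
  shows "mat_rpow A 1 = A"
  using assms by (elim psd_spectral) (auto simp: mat_rpow_spec intro!: spec_mat_cong)

lemma tendsto_powr_exponent:
  fixes x :: real
  assumes "(s \<longlongrightarrow> t) F" "0 \<le> x"
  shows "((\<lambda>j. x powr s j) \<longlongrightarrow> x powr t) F"
  using assms by (cases "x = 0") (auto intro: tendsto_powr)

lemma tendsto_mat_rpow:
  assumes A: "A \<in> psd_mats n" and s: "(s \<longlongrightarrow> t) F" and "i < n" "j < n"
  shows "((\<lambda>l. mat_rpow A (s l) $$ (i, j)) \<longlongrightarrow> mat_rpow A t $$ (i, j)) F"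
proof -
  obtain U d where U: "U \<in> unitary_mats n" "A = spec_mat n U d" "\<And>i. i < n \<Longrightarrow> 0 \<le> d i"
    using psd_spectral[OF A] by blast
  have "((\<lambda>l. \<Sum>m<n. complex_of_real (d m powr s l) * (U $$ (i, m) * cnj (U $$ (j, m)))) \<longlongrightarrow>
     (\<Sum>m<n. complex_of_real (d m powr t) * (U $$ (i, m) * cnj (U $$ (j, m))))) F"
    by (intro tendsto_intros tendsto_powr_exponent s) (use U in auto)
  then show ?thesis
    using assms unitaryD(1)[OF U(1)] U(1,3) by (simp add: U(2) mat_rpow_spec spec_mat_index)
qed

text \<open>For positive semidefinite \<open>A\<close> and \<open>k\<close> at most its size this is
  the norm of the \<open>k\<close>-th exterior power of \<open>A\<close>; at full size it is the
  determinant.\<close>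

definition eig_prod :: "nat \<Rightarrow> complex mat \<Rightarrow> real" where
  "eig_prod k A = (\<Prod>i<k. eigvals_desc A ! i)"

lemma eig_prod_spec:
  assumes "U \<in> unitary_mats n" "\<And>i j. i \<le> j \<Longrightarrow> j < n \<Longrightarrow> d j \<le> d i" "k \<le> n"
  shows "eig_prod k (spec_mat n U d) = (\<Prod>i<k. d i)"
proof -
  have "eigvals_desc (spec_mat n U d) = map d [0..<n]"
    using assms by (intro eigvals_desc_spec)
  then show ?thesis
    using assms(3) by (auto simp: eig_prod_def intro!: prod.cong)
qed

lemma eig_prod_nonneg:
  assumes "A \<in> psd_mats n" "k \<le> n"
  shows "0 \<le> eig_prod k A"
  using assms by (elim psd_spectral) (auto simp: eig_prod_spec intro!: prod_nonneg)

lemma eig_prod_rpow: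
  assumes "A \<in> psd_mats n" "k \<le> n" "0 \<le> r"
  shows "eig_prod k (mat_rpow A r) = eig_prod k A powr r"
proof -
  obtain U d where U: "U \<in> unitary_mats n" "A = spec_mat n U d"
    "\<And>i. i < n \<Longrightarrow> 0 \<le> d i" "\<And>i j. i \<le> j \<Longrightarrow> j < n \<Longrightarrow> d j \<le> d i"
    using psd_spectral[OF assms(1)] by blast
  have "mat_rpow A r = spec_mat n U (\<lambda>i. d i powr r)"
    unfolding U(2) by (rule mat_rpow_spec[OF U(1)]) (use U(3) in auto)
  moreover have "eig_prod k (spec_mat n U (\<lambda>i. d i powr r)) = (\<Prod>i<k. d i powr r)"
    by (rule eig_prod_spec) (use U assms in \<open>auto intro: powr_mono2\<close>)
  ultimately have "eig_prod k (mat_rpow A r) = (\<Prod>i<k. d i powr r)"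
    by simp
  also have "\<dots> = (\<Prod>i<k. d i) powr r"
    by (simp add: prod_powr_distrib)
  also have "(\<Prod>i<k. d i) = eig_prod k A"
    unfolding U(2) by (rule eig_prod_spec[OF U(1), symmetric]) (use U(4) assms(2) in auto)
  finally show ?thesis .
qed

lemma det_spec:
  assumes U: "U \<in> unitary_mats n"
  shows "det (spec_mat n U d) = complex_of_real (\<Prod>i<n. d i)"
proof -
  note u = unitaryD[OF U]
  let ?D = "mat_diag n (\<lambda>i. complex_of_real (d i))"
  have "det U * det (mat_adjoint U) = det (U * mat_adjoint U)"
    using u by (intro det_mult[symmetric]) auto
  then have 1: "det U * det (mat_adjoint U) = 1"
    using u by simp
  have "det (spec_mat n U d) = det U * det ?D * det (mat_adjoint U)"
    using u by (simp add: spec_mat_def det_mult[of _ n])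
  also have "\<dots> = det ?D"
    using 1 by (simp add: mult.commute mult.left_commute)
  also have "\<dots> = prod_list (diag_mat ?D)"
    by (rule det_upper_triangular[of _ n]) (auto simp: mat_diag_def)
  also have "diag_mat ?D = map (\<lambda>i. complex_of_real (d i)) [0..<n]"
    by (auto simp: diag_mat_def mat_diag_def)
  also have "prod_list \<dots> = (\<Prod>i\<in>set [0..<n]. complex_of_real (d i))"
    by (rule prod.distinct_set_conv_list[symmetric]) simp
  finally show ?thesis
    by (simp add: lessThan_atLeast0)
qed

lemma det_psd:
  assumes "A \<in> psd_mats n"
  shows "det A = complex_of_real (eig_prod n A)"
proof -
  obtain U d where U: "U \<in> unitary_mats n" "A = spec_mat n U d"
    "\<And>i j. i \<le> j \<Longrightarrow> j < n \<Longrightarrow> d j \<le> d i"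
    using psd_spectral[OF assms(1)] by blast
  have "eig_prod n A = (\<Prod>i<n. d i)"
    unfolding U(2) by (rule eig_prod_spec[OF U(1)]) (use U(3) in auto)
  then show ?thesis
    unfolding U(2) det_spec[OF U(1)] by (simp only:)
qed

lemma det_mat_rpow:
  assumes "A \<in> psd_mats n"
  shows "det (mat_rpow A r) = complex_of_real (eig_prod n A powr r)"
proof -
  obtain U d where U: "U \<in> unitary_mats n" "A = spec_mat n U d"
    "\<And>i. i < n \<Longrightarrow> 0 \<le> d i" "\<And>i j. i \<le> j \<Longrightarrow> j < n \<Longrightarrow> d j \<le> d i"
    using psd_spectral[OF assms(1)] by blast
  have "(\<Prod>i<n. d i powr r) = (\<Prod>i<n. d i) powr r"
    by (simp add: prod_powr_distrib)
  moreover have "eig_prod n A = (\<Prod>i<n. d i)"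
    unfolding U(2) by (rule eig_prod_spec[OF U(1)]) (use U(4) in auto)
  moreover have "mat_rpow A r = spec_mat n U (\<lambda>i. d i powr r)"
    unfolding U(2) by (rule mat_rpow_spec[OF U(1)]) (use U(3) in auto)
  ultimately show ?thesis
    using det_spec[OF U(1), of "\<lambda>i. d i powr r"] by (simp only:)
qed

section \<open>Gram determinants and exterior powers\<close>

text \<open>The index set produced by \<open>det_linear_rows_sum\<close>; values outside
  \<open>{0..<k}\<close> are pinned so that each choice of row indices is represented by one
  function.\<close>

abbreviation index_maps :: "nat \<Rightarrow> nat \<Rightarrow> (nat \<Rightarrow> nat) set" where
  "index_maps k n \<equiv> {f. (\<forall>i\<in>{0..<k}. f i \<in> {0..<n}) \<and> (\<forall>i. i \<notin> {0..<k} \<longrightarrow> f i = i)}"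

text \<open>Each row of \<open>P * Q\<close> is a combination of rows of \<open>Q\<close>;
  multilinearity of the determinant leaves one choice \<open>f i\<close> for each row.\<close>

lemma det_mult_index_maps:
  fixes P Q :: "'a :: comm_ring_1 mat"
  assumes P: "P \<in> carrier_mat k n" and Q: "Q \<in> carrier_mat n k"
  shows "det (P * Q) = (\<Sum>f\<in>index_maps k n. (\<Prod>i=0..<k. P $$ (i, f i)) *
    det (mat k k (\<lambda>(i, j). Q $$ (f i, j))))"
proof -
  have "det (P * Q) = det (mat\<^sub>r k k (\<lambda>i. finsum_vec TYPE('a) k (\<lambda>j. P $$ (i, j) \<cdot>\<^sub>v row Q j) {0..<n}))"
    using mat_mul_finsum_alt[OF P Q] by simp
  also have "\<dots> = (\<Sum>f\<in>index_maps k n. det (mat\<^sub>r k k (\<lambda>i. P $$ (i, f i) \<cdot>\<^sub>v row Q (f i))))"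
    by (rule det_linear_rows_sum) (use Q in auto)
  also have "\<dots> = (\<Sum>f\<in>index_maps k n. (\<Prod>i=0..<k. P $$ (i, f i)) * det (mat\<^sub>r k k (\<lambda>i. row Q (f i))))"
    by (rule sum.cong[OF refl], rule det_rows_mul) (use Q in auto)
  also have "\<dots> = (\<Sum>f\<in>index_maps k n. (\<Prod>i=0..<k. P $$ (i, f i)) * det (mat k k (\<lambda>(i, j). Q $$ (f i, j))))"
  proof (rule sum.cong[OF refl])
    fix f assume f: "f \<in> index_maps k n"
    have "mat\<^sub>r k k (\<lambda>i. row Q (f i)) = mat k k (\<lambda>(i, j). Q $$ (f i, j))"
      by (rule eq_matI) (use f Q in auto)
    then show "(\<Prod>i=0..<k. P $$ (i, f i)) * det (mat\<^sub>r k k (\<lambda>i. row Q (f i))) =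
      (\<Prod>i=0..<k. P $$ (i, f i)) * det (mat k k (\<lambda>(i, j). Q $$ (f i, j)))" by simp
  qed
  finally show ?thesis .
qed

text \<open>The Cauchy--Binet formula, summed over all index maps instead of all increasing ones; each
  \<open>k\<close>-subset of the indices is counted \<open>k!\<close> times, and maps that are not injective contribute 0.\<close>

lemma cauchy_binet_index_maps:
  fixes P Q :: "'a :: comm_ring_1 mat"
  assumes P: "P \<in> carrier_mat k n" and Q: "Q \<in> carrier_mat n k"
  shows "of_nat (fact k) * det (P * Q) = (\<Sum>f\<in>index_maps k n.
    det (mat k k (\<lambda>(i, j). P $$ (i, f j))) * det (mat k k (\<lambda>(i, j). Q $$ (f i, j))))"
proof -
  let ?S = "{\<pi>. \<pi> permutes {0..<k}}"
  let ?Q = "\<lambda>f. mat k k (\<lambda>(i, j). Q $$ (f i, j))"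
  \<comment> \<open>\<open>det_mult_index_maps\<close> has a minor of \<open>Q\<close> but only a
    single product of entries of \<open>P\<close>. Replacing \<open>f\<close> by
    \<open>f \<circ> \<pi>\<close> puts the sign of \<open>\<pi>\<close> on the minor of
    \<open>Q\<close>; summing over all \<open>\<pi>\<close> then assembles the Leibniz formula for
    the minor of \<open>P\<close>.\<close>
  have perm: "det (P * Q) = (\<Sum>f\<in>index_maps k n. (\<Prod>i=0..<k. P $$ (i, f (\<pi> i))) * (signof \<pi> * det (?Q f)))"
    if \<pi>: "\<pi> permutes {0..<k}" for \<pi>
  proof -
    have inv: "Hilbert_Choice.inv \<pi> permutes {0..<k}"
      using \<pi> by (rule permutes_inv)
    have in_range: "\<sigma> i \<in> {0..<k} \<longleftrightarrow> i \<in> {0..<k}" if "\<sigma> permutes {0..<k}" for \<sigma> i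
      using that by (rule permutes_in_image)
    have comp: "f \<circ> \<sigma> \<in> index_maps k n" if "f \<in> index_maps k n" "\<sigma> permutes {0..<k}" for f \<sigma>
      using that in_range[OF that(2)] permutes_not_in[OF that(2)] by (auto simp: comp_def)
    have "det (P * Q) = (\<Sum>f\<in>index_maps k n. (\<Prod>i=0..<k. P $$ (i, f i)) * det (?Q f))"
      by (rule det_mult_index_maps[OF P Q])
    also have "\<dots> = (\<Sum>f\<in>index_maps k n. (\<Prod>i=0..<k. P $$ (i, (f \<circ> \<pi>) i)) * det (?Q (f \<circ> \<pi>)))"
    proof (rule sum.reindex_bij_witness[of _ "\<lambda>f. f \<circ> \<pi>" "\<lambda>f. f \<circ> Hilbert_Choice.inv \<pi>"])
      fix f assume f: "f \<in> index_maps k n"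
      show "f \<circ> Hilbert_Choice.inv \<pi> \<in> index_maps k n"
        using f inv by (rule comp)
      show "f \<circ> \<pi> \<in> index_maps k n"
        using f \<pi> by (rule comp)
      show "(f \<circ> Hilbert_Choice.inv \<pi>) \<circ> \<pi> = f" "(f \<circ> \<pi>) \<circ> Hilbert_Choice.inv \<pi> = f"
        using permutes_inv_o[OF \<pi>] by (simp_all add: comp_assoc)
      then show "(\<Prod>i=0..<k. P $$ (i, ((f \<circ> Hilbert_Choice.inv \<pi>) \<circ> \<pi>) i)) * det (?Q ((f \<circ> Hilbert_Choice.inv \<pi>) \<circ> \<pi>)) =
        (\<Prod>i=0..<k. P $$ (i, f i)) * det (?Q f)" by simp
    qed
    also have "\<dots> = (\<Sum>f\<in>index_maps k n. (\<Prod>i=0..<k. P $$ (i, f (\<pi> i))) * (signof \<pi> * det (?Q f)))"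
    proof (rule sum.cong[OF refl])
      fix f
      have "?Q (f \<circ> \<pi>) = mat k k (\<lambda>(i, j). ?Q f $$ (\<pi> i, j))"
        by (rule eq_matI) (use in_range[OF \<pi>] in auto)
      then have "det (?Q (f \<circ> \<pi>)) = signof \<pi> * det (?Q f)"
        using det_permute_rows[OF _ \<pi>, of "?Q f"] by simp
      then show "(\<Prod>i=0..<k. P $$ (i, (f \<circ> \<pi>) i)) * det (?Q (f \<circ> \<pi>)) =
        (\<Prod>i=0..<k. P $$ (i, f (\<pi> i))) * (signof \<pi> * det (?Q f))"
        by (simp add: comp_def)
    qed
    finally show ?thesis .
  qed
  have "of_nat (fact k) * det (P * Q) = (\<Sum>\<pi>\<in>?S. det (P * Q))"
    by (simp add: card_permutations[of _ k])
  also have "\<dots> = (\<Sum>\<pi>\<in>?S. \<Sum>f\<in>index_maps k n. (\<Prod>i=0..<k. P $$ (i, f (\<pi> i))) * (signof \<pi> * det (?Q f)))"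
    by (rule sum.cong[OF refl]) (use perm in blast)
  also have "\<dots> = (\<Sum>f\<in>index_maps k n. \<Sum>\<pi>\<in>?S. (\<Prod>i=0..<k. P $$ (i, f (\<pi> i))) * (signof \<pi> * det (?Q f)))"
    by (rule sum.swap)
  also have "\<dots> = (\<Sum>f\<in>index_maps k n. det (mat k k (\<lambda>(i, j). P $$ (i, f j))) * det (?Q f))"
  proof (rule sum.cong[OF refl])
    fix f
    have "det (mat k k (\<lambda>(i, j). P $$ (i, f j))) = (\<Sum>\<pi>\<in>?S. signof \<pi> * (\<Prod>i=0..<k. P $$ (i, f (\<pi> i))))"
      by (subst det_def'[of _ k]) (auto intro!: sum.cong prod.cong simp: permutes_in_image)
    then show "(\<Sum>\<pi>\<in>?S. (\<Prod>i=0..<k. P $$ (i, f (\<pi> i))) * (signof \<pi> * det (?Q f))) =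
        det (mat k k (\<lambda>(i, j). P $$ (i, f j))) * det (?Q f)"
      by (simp add: sum_distrib_right sum_distrib_left ac_simps)
  qed
  finally show ?thesis .
qed

text \<open>The squared volume spanned by the columns of \<open>X\<close>, i.e. the squared norm of
  their wedge product.\<close>

definition gram_det :: "complex mat \<Rightarrow> real" where
  "gram_det X = Re (det (mat_adjoint X * X))"

lemma gram_det_eq_sum:
  assumes X: "X \<in> carrier_mat n k"
  shows "fact k * gram_det X =
    (\<Sum>f\<in>index_maps k n. (cmod (det (mat k k (\<lambda>(i, j). X $$ (f i, j)))))\<^sup>2)"
proof -
  let ?X = "\<lambda>f. mat k k (\<lambda>(i, j). X $$ (f i, j))"
  have "of_nat (fact k) * det (mat_adjoint X * X) =
    (\<Sum>f\<in>index_maps k n. det (mat k k (\<lambda>(i, j). mat_adjoint X $$ (i, f j))) * det (?X f))"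
    by (rule cauchy_binet_index_maps) (use X in auto)
  also have "\<dots> = (\<Sum>f\<in>index_maps k n. complex_of_real ((cmod (det (?X f)))\<^sup>2))"
  proof (rule sum.cong[OF refl])
    fix f assume f: "f \<in> index_maps k n"
    have "mat k k (\<lambda>(i, j). mat_adjoint X $$ (i, f j)) = mat_adjoint (?X f)"
      by (rule eq_matI) (use f X in auto)
    then have "det (mat k k (\<lambda>(i, j). mat_adjoint X $$ (i, f j))) = cnj (det (?X f))"
      using det_mat_adjoint[of "?X f" k] by simp
    then show "det (mat k k (\<lambda>(i, j). mat_adjoint X $$ (i, f j))) * det (?X f) = complex_of_real ((cmod (det (?X f)))\<^sup>2)"
      by (simp only: complex_norm_square mult.commute)
  qed
  finally have "Re (of_nat (fact k) * det (mat_adjoint X * X)) = (\<Sum>f\<in>index_maps k n. (cmod (det (?X f)))\<^sup>2)"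
    by (simp flip: of_real_sum)
  then show ?thesis
    by (simp add: gram_det_def)
qed

lemma gram_det_nonneg:
  assumes "X \<in> carrier_mat n k"
  shows "0 \<le> gram_det X"
proof -
  have "0 \<le> fact k * gram_det X"
    unfolding gram_det_eq_sum[OF assms] by (rule sum_nonneg) simp
  then show ?thesis
    using mult_le_cancel_left_pos[of "fact k" 0 "gram_det X"] by simp
qed

text \<open>Remove the largest index \<open>m\<close> of \<open>S\<close>. Since \<open>S\<close>
  has \<open>k + 1\<close> elements, all at most \<open>m\<close>, one has \<open>k \<le> m\<close>
  and so \<open>d m \<le> d k\<close>.\<close>

lemma prod_antimono_le:
  fixes d :: "nat \<Rightarrow> real"
  assumes "finite S" "S \<subseteq> {..<n}" "card S = k"
    and "\<And>i. i < n \<Longrightarrow> 0 \<le> d i" "\<And>i j. i \<le> j \<Longrightarrow> j < n \<Longrightarrow> d j \<le> d i"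
  shows "(\<Prod>i\<in>S. d i) \<le> (\<Prod>i<k. d i)"
  using assms(1-3)
proof (induction k arbitrary: S)
  case (Suc k)
  define m where "m = Max S"
  have ne: "S \<noteq> {}"
    using Suc.prems by auto
  have m: "m \<in> S"
    unfolding m_def using Suc.prems ne by simp
  have "S \<subseteq> {..m}"
    unfolding m_def using Suc.prems by auto
  then have "card S \<le> card {..m}"
    by (rule card_mono[rotated]) simp
  then have km: "k \<le> m" "m < n"
    using Suc.prems m by auto
  have "(\<Prod>i\<in>S. d i) = d m * (\<Prod>i\<in>S - {m}. d i)"
    using Suc.prems m by (simp add: prod.remove)
  also have "\<dots> \<le> d k * (\<Prod>i<k. d i)"
  proof (rule mult_mono)
    show "d m \<le> d k"
      using km by (rule assms(5))
    show "(\<Prod>i\<in>S - {m}. d i) \<le> (\<Prod>i<k. d i)"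
      by (rule Suc.IH) (use Suc.prems m in auto)
    show "0 \<le> d k"
      using km by (intro assms(4)) simp
    show "0 \<le> (\<Prod>i\<in>S - {m}. d i)"
      using Suc.prems by (intro prod_nonneg assms(4)) auto
  qed
  finally show ?case
    by (simp add: mult.commute)
qed simp

text \<open>The diagonal factor multiplies the minor on the rows \<open>f\<close> by the product of
  the \<open>d (f i)\<close>. For injective \<open>f\<close> this is at most the product of the
  \<open>k\<close> largest; otherwise the minor has two equal rows and vanishes.\<close>

lemma gram_det_diag_mult:
  assumes X: "X \<in> carrier_mat n k"
    and d: "\<And>i. i < n \<Longrightarrow> 0 \<le> d i" "\<And>i j. i \<le> j \<Longrightarrow> j < n \<Longrightarrow> d j \<le> d i"
  shows "gram_det (mat_diag n (\<lambda>i. complex_of_real (d i)) * X) \<le> (\<Prod>i<k. d i)\<^sup>2 * gram_det X"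
proof -
  let ?D = "mat_diag n (\<lambda>i. complex_of_real (d i))"
  let ?X = "\<lambda>f. mat k k (\<lambda>(i, j). X $$ (f i, j))"
  have DX: "?D * X \<in> carrier_mat n k"
    using X by (intro mult_carrier_mat) auto
  have "fact k * gram_det (?D * X) = (\<Sum>f\<in>index_maps k n. (cmod (det (mat k k (\<lambda>(i, j). (?D * X) $$ (f i, j)))))\<^sup>2)"
    by (rule gram_det_eq_sum[OF DX])
  also have "\<dots> \<le> (\<Sum>f\<in>index_maps k n. (\<Prod>i<k. d i)\<^sup>2 * (cmod (det (?X f)))\<^sup>2)"
  proof (rule sum_mono)
    fix f assume f: "f \<in> index_maps k n"
    have "mat k k (\<lambda>(i, j). (?D * X) $$ (f i, j)) =
      mat\<^sub>r k k (\<lambda>i. complex_of_real (d (f i)) \<cdot>\<^sub>v row (?X f) i)"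
      unfolding mat_diag_mult_left[OF X]
      by (rule eq_matI) (use f X in auto)
    also have "det \<dots> = (\<Prod>i=0..<k. complex_of_real (d (f i))) * det (mat\<^sub>r k k (row (?X f)))"
      by (rule det_rows_mul) auto
    also have "mat\<^sub>r k k (row (?X f)) = ?X f"
      by (rule eq_matI) auto
    finally have eq: "det (mat k k (\<lambda>(i, j). (?D * X) $$ (f i, j))) = (\<Prod>i=0..<k. complex_of_real (d (f i))) * det (?X f)" .
    have abs: "cmod (\<Prod>i=0..<k. complex_of_real (d (f i))) = (\<Prod>i=0..<k. d (f i))"
      using f d(1) by (auto simp: prod_norm[symmetric] intro!: prod.cong)
    show "(cmod (det (mat k k (\<lambda>(i, j). (?D * X) $$ (f i, j)))))\<^sup>2 \<le> (\<Prod>i<k. d i)\<^sup>2 * (cmod (det (?X f)))\<^sup>2"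
    proof (cases "inj_on f {0..<k}")
      case True
      have "(\<Prod>i=0..<k. d (f i)) = (\<Prod>i\<in>f ` {0..<k}. d i)"
        using True by (simp add: prod.reindex)
      also have "\<dots> \<le> (\<Prod>i<k. d i)"
        by (rule prod_antimono_le[where n = n]) (use f d True in \<open>auto simp: card_image\<close>)
      finally have "(\<Prod>i=0..<k. d (f i)) \<le> (\<Prod>i<k. d i)" .
      moreover have "0 \<le> (\<Prod>i=0..<k. d (f i))"
        using f d(1) by (intro prod_nonneg) auto
      ultimately show ?thesis
        unfolding eq norm_mult abs power_mult_distrib by (intro mult_right_mono power_mono) auto
    next
      case False
      then obtain i j where ij: "i < k" "j < k" "i \<noteq> j" "f i = f j"
        by (auto simp: inj_on_def)
      have "det (?X f) = 0"
        by (rule det_identical_rows[of _ k i j]) (use ij in auto)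
      then show ?thesis
        using eq by simp
    qed
  qed
  also have "\<dots> = fact k * ((\<Prod>i<k. d i)\<^sup>2 * gram_det X)"
    using gram_det_eq_sum[OF X] by (simp add: mult.left_commute flip: sum_distrib_left)
  finally show ?thesis
    by simp
qed

lemma adjoint_mult_self:
  fixes M X :: "complex mat"
  assumes "M \<in> carrier_mat n m" "X \<in> carrier_mat m k"
  shows "mat_adjoint (M * X) * (M * X) = mat_adjoint X * (mat_adjoint M * M * X)"
proof -
  have "mat_adjoint (M * X) * (M * X) = mat_adjoint X * mat_adjoint M * (M * X)"
    using assms by (simp add: mat_adjoint_mult)
  also have "\<dots> = mat_adjoint X * (mat_adjoint M * (M * X))"
    using assms by (intro assoc_mult_mat[of _ k m _ n _ k] mult_carrier_mat[of _ n m]) auto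
  also have "mat_adjoint M * (M * X) = mat_adjoint M * M * X"
    using assms by (intro assoc_mult_mat[symmetric]) auto
  finally show ?thesis .
qed

text \<open>Volumes of images depend on \<open>M\<close> only through
  \<open>mat_adjoint M * M\<close>. This lets \<open>M\<close> be exchanged for its modulus,
  replacing a polar decomposition.\<close>

lemma gram_det_mult_cong:
  assumes "M \<in> carrier_mat n m" "N \<in> carrier_mat l m" "X \<in> carrier_mat m k"
    and "mat_adjoint M * M = mat_adjoint N * N"
  shows "gram_det (M * X) = gram_det (N * X)"
  using assms by (simp add: gram_det_def adjoint_mult_self[of M n m] adjoint_mult_self[of N l m])

lemma gram_det_isometry_mult:
  assumes "U \<in> carrier_mat n m" "mat_adjoint U * U = 1\<^sub>m m" "X \<in> carrier_mat m k"
  shows "gram_det (U * X) = gram_det X"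
  using gram_det_mult_cong[OF assms(1) one_carrier_mat assms(3)] assms by simp

lemma gram_det_mult_right:
  assumes X: "X \<in> carrier_mat n k" and T: "T \<in> carrier_mat k k"
  shows "gram_det (X * T) = (cmod (det T))\<^sup>2 * gram_det X"
proof -
  define G where "G = mat_adjoint X * X"
  have G: "G \<in> carrier_mat k k"
    unfolding G_def using X by (intro mult_carrier_mat) auto
  have "det (mat_adjoint (X * T) * (X * T)) = cnj (det T) * (det G * det T)"
    unfolding adjoint_mult_self[OF X T] G_def[symmetric] using T G
    by (simp add: det_mult[of _ k] det_mat_adjoint)
  also have "\<dots> = complex_of_real ((cmod (det T))\<^sup>2) * det G"
    unfolding complex_norm_square by (simp only: ac_simps)
  also have "det G = det (mat_adjoint X * X)"
    by (simp only: G_def)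
  finally show ?thesis
    by (simp add: gram_det_def)
qed

lemma gram_det_psd_mult:
  assumes A: "A \<in> psd_mats n" and X: "X \<in> carrier_mat n k" and k: "k \<le> n"
  shows "gram_det (A * X) \<le> (eig_prod k A)\<^sup>2 * gram_det X"
proof -
  obtain U d where U: "U \<in> unitary_mats n" and AU: "A = spec_mat n U d"
    and d: "\<And>i. i < n \<Longrightarrow> 0 \<le> d i" "\<And>i j. i \<le> j \<Longrightarrow> j < n \<Longrightarrow> d j \<le> d i"
    using psd_spectral[OF A] by blast
  note u = unitaryD[OF U]
  let ?D = "mat_diag n (\<lambda>i. complex_of_real (d i))"
  have UX: "mat_adjoint U * X \<in> carrier_mat n k"
    using u X by (intro mult_carrier_mat) auto
  have DUX: "?D * (mat_adjoint U * X) \<in> carrier_mat n k"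
    by (rule mult_carrier_mat[OF mat_diag_dim UX])
  have "A * X = U * (?D * (mat_adjoint U * X))"
    using u X UX by (simp add: AU spec_mat_def assoc_mult_mat[of _ n n _ n _ k])
  then have "gram_det (A * X) = gram_det (?D * (mat_adjoint U * X))"
    using gram_det_isometry_mult[OF u(1,2) DUX] by simp
  also have "\<dots> \<le> (\<Prod>i<k. d i)\<^sup>2 * gram_det (mat_adjoint U * X)"
    using UX d by (rule gram_det_diag_mult)
  also have "gram_det (mat_adjoint U * X) = gram_det X"
    by (rule gram_det_isometry_mult[of _ n n]) (use u X in auto)
  also have "(\<Prod>i<k. d i) = eig_prod k A"
    unfolding AU by (rule eig_prod_spec[OF U, symmetric]) (use d k in auto)
  finally show ?thesis .
qed

text \<open>The equality case of \<open>gram_det_psd_mult\<close>: the columns of \<open>W\<close>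
  are leading eigenvectors and \<open>T\<close> is the diagonal of their eigenvalues, of which only
  the determinant is used later.\<close>

lemma psd_top_eigenvectors:
  assumes A: "A \<in> psd_mats n" and k: "k \<le> n"
  obtains W T where "W \<in> carrier_mat n k" "mat_adjoint W * W = 1\<^sub>m k" "T \<in> carrier_mat k k"
    "A * W = W * T" "det T = complex_of_real (eig_prod k A)"
proof -
  obtain U d where U: "U \<in> unitary_mats n" and AU: "A = spec_mat n U d"
    and d: "\<And>i. i < n \<Longrightarrow> 0 \<le> d i" "\<And>i j. i \<le> j \<Longrightarrow> j < n \<Longrightarrow> d j \<le> d i"
    using psd_spectral[OF A] by blast
  note u = unitaryD[OF U]
  define E where "E = mat n k (\<lambda>(i, j). if i = j then 1 else 0 :: complex)"
  let ?D = "mat_diag n (\<lambda>i. complex_of_real (d i))" and ?T = "mat_diag k (\<lambda>i. complex_of_real (d i))"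
  have E: "E \<in> carrier_mat n k"
    by (simp add: E_def)
  have "mat_adjoint E * E = 1\<^sub>m k"
  proof (rule eq_matI)
    fix i j assume "i < dim_row (1\<^sub>m k :: complex mat)" "j < dim_col (1\<^sub>m k :: complex mat)"
    then have ij: "i < k" "j < k" by auto
    then have "(mat_adjoint E * E) $$ (i, j) = (\<Sum>l = 0..<n. if l = i then (if l = j then 1 else 0) else 0)"
    proof -
      have "(mat_adjoint E * E) $$ (i, j) = (\<Sum>l = 0..<n. cnj (E $$ (l, i)) * E $$ (l, j))"
        using ij E by (simp add: scalar_prod_def)
      also have "\<dots> = (\<Sum>l = 0..<n. if l = i then (if l = j then 1 else 0) else 0)"
        by (rule sum.cong) (use ij in \<open>auto simp: E_def\<close>)
      finally show ?thesis .
    qed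
    also have "\<dots> = (if i = j then 1 else 0)"
      using ij k by (simp add: sum.delta)
    finally show "(mat_adjoint E * E) $$ (i, j) = 1\<^sub>m k $$ (i, j)"
      using ij by simp
  qed (use E in auto)
  moreover have DE: "?D * E = E * ?T"
    unfolding mat_diag_mult_left[OF E] mat_diag_mult_right[OF E] by (rule eq_matI) (auto simp: E_def)
  moreover have UE: "U * E \<in> carrier_mat n k" and DEc: "?D * E \<in> carrier_mat n k" and UUE: "mat_adjoint U * (U * E) = E"
    using u E by (auto intro!: mult_carrier_mat mult_cancel_adjacent)
  moreover have "mat_adjoint (U * E) * (U * E) = mat_adjoint E * (mat_adjoint U * U * E)"
    by (rule adjoint_mult_self[OF u(1) E])
  ultimately have 1: "mat_adjoint (U * E) * (U * E) = 1\<^sub>m k"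
    using u E by simp
  have "A * (U * E) = U * (?D * (mat_adjoint U * (U * E)))"
    using u E UE DEc by (simp add: AU spec_mat_def assoc_mult_mat[of _ n n _ n _ k] UUE)
  also have "\<dots> = U * E * ?T"
    unfolding UUE DE using u E by (intro assoc_mult_mat[symmetric, of _ n n _ k _ k]) auto
  finally have 2: "A * (U * E) = U * E * ?T" .
  have "spec_mat k (1\<^sub>m k) d = ?T"
    by (simp add: spec_mat_def right_mult_one_mat[of _ k k] left_mult_one_mat[of _ k k])
  then have "det ?T = complex_of_real (\<Prod>i<k. d i)"
    using det_spec[of "1\<^sub>m k" k d] by (simp add: unitary_mats_def)
  also have "(\<Prod>i<k. d i) = eig_prod k A"
    unfolding AU by (rule eig_prod_spec[OF U, symmetric]) (use d k in auto)
  finally have "det ?T = complex_of_real (eig_prod k A)" .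
  then show thesis
    using that[OF UE 1 _ 2] by simp
qed

text \<open>\<open>vol_bound n k M c\<close> says that the squared norm of the \<open>k\<close>-th exterior power of \<open>M\<close> is at most \<open>c\<close>.\<close>

definition vol_bound :: "nat \<Rightarrow> nat \<Rightarrow> complex mat \<Rightarrow> real \<Rightarrow> bool" where
  "vol_bound n k M c \<longleftrightarrow> (\<forall>X \<in> carrier_mat n k. gram_det (M * X) \<le> c * gram_det X)"

lemma vol_bound_eig_prod:
  assumes M: "M \<in> carrier_mat n n" and k: "k \<le> n"
  shows "vol_bound n k M (eig_prod k (mat_adjoint M * M))"
  unfolding vol_bound_def
proof
  fix X :: "complex mat" assume X: "X \<in> carrier_mat n k"
  define S where "S = mat_rpow (mat_adjoint M * M) (1/2)"
  have H: "mat_adjoint M * M \<in> psd_mats n"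
    using M by (rule adjoint_self_psd)
  have S: "S \<in> psd_mats n"
    unfolding S_def using H by (rule mat_rpow_psd)
  have "S * S = mat_adjoint M * M"
    unfolding S_def using mat_rpow_add[OF H] mat_rpow_one[OF H] by simp
  then have "gram_det (M * X) = gram_det (S * X)"
    using gram_det_mult_cong[OF M psd_matsD(1)[OF S] X] psd_matsD(2)[OF S] by simp
  also have "\<dots> \<le> (eig_prod k S)\<^sup>2 * gram_det X"
    using S X k by (rule gram_det_psd_mult)
  also have "eig_prod k S = eig_prod k (mat_adjoint M * M) powr (1/2)"
    unfolding S_def using H k by (rule eig_prod_rpow) simp
  also have "\<dots>\<^sup>2 = eig_prod k (mat_adjoint M * M)"
    using eig_prod_nonneg[OF H k] by (simp add: powr_half_sqrt)
  finally show "gram_det (M * X) \<le> eig_prod k (mat_adjoint M * M) * gram_det X" .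
qed

text \<open>Testing the bound on leading eigenvectors of \<open>mat_adjoint M * M\<close>. With
  \<open>vol_bound_eig_prod\<close> this identifies the least volume bound.\<close>

lemma eig_prod_le_vol_bound:
  assumes M: "M \<in> carrier_mat n n" and k: "k \<le> n" and c: "vol_bound n k M c"
  shows "eig_prod k (mat_adjoint M * M) \<le> c"
proof -
  have H: "mat_adjoint M * M \<in> psd_mats n"
    using M by (rule adjoint_self_psd)
  obtain W T where W: "W \<in> carrier_mat n k" "mat_adjoint W * W = 1\<^sub>m k" "T \<in> carrier_mat k k"
    "mat_adjoint M * M * W = W * T" "det T = complex_of_real (eig_prod k (mat_adjoint M * M))"
    using psd_top_eigenvectors[OF H k] by blast
  have "mat_adjoint (M * W) * (M * W) = mat_adjoint W * (W * T)"
    unfolding adjoint_mult_self[OF M W(1)] W(4) ..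
  also have "\<dots> = T"
    using W by (subst assoc_mult_mat[symmetric, of _ k n _ k _ k]) auto
  finally have "gram_det (M * W) = eig_prod k (mat_adjoint M * M)"
    by (simp add: gram_det_def W(5))
  moreover have "gram_det W = 1"
    by (simp add: gram_det_def W(2))
  ultimately show ?thesis
    using c W(1) by (auto simp: vol_bound_def)
qed

lemma vol_bound_mult:
  assumes "M \<in> carrier_mat n n" "N \<in> carrier_mat n n" "vol_bound n k M c" "vol_bound n k N d" "0 \<le> c"
  shows "vol_bound n k (M * N) (c * d)"
  unfolding vol_bound_def
proof
  fix X :: "complex mat" assume X: "X \<in> carrier_mat n k"
  have NX: "N * X \<in> carrier_mat n k"
    using assms X by (intro mult_carrier_mat) auto
  have "gram_det (M * N * X) = gram_det (M * (N * X))"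
    using assms X by (simp add: assoc_mult_mat[of _ n n _ n _ k])
  also have "\<dots> \<le> c * gram_det (N * X)"
    using assms(3) NX by (simp add: vol_bound_def)
  also have "\<dots> \<le> c * (d * gram_det X)"
    using assms(4,5) X by (simp add: vol_bound_def mult_left_mono)
  finally show "gram_det (M * N * X) \<le> c * d * gram_det X"
    by simp
qed

lemma vol_bound_mono:
  assumes "vol_bound n k M c" "c \<le> d"
  shows "vol_bound n k M d"
  unfolding vol_bound_def
proof
  fix X :: "complex mat" assume X: "X \<in> carrier_mat n k"
  then have "gram_det (M * X) \<le> c * gram_det X"
    using assms(1) by (simp add: vol_bound_def)
  also have "\<dots> \<le> d * gram_det X"
    using assms(2) gram_det_nonneg[OF X] by (rule mult_right_mono)
  finally show "gram_det (M * X) \<le> d * gram_det X" .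
qed

lemma vol_bound_nonneg:
  assumes M: "M \<in> carrier_mat n n" and k: "k \<le> n" and c: "vol_bound n k M c"
  shows "0 \<le> c"
  using eig_prod_nonneg[OF adjoint_self_psd[OF M] k] eig_prod_le_vol_bound[OF assms] by linarith

text \<open>An operator and its adjoint have the same norm, also on exterior powers. For leading
  eigenvectors \<open>W\<close> of \<open>N\<close> the frame \<open>mat_adjoint M * W\<close> has
  squared volume \<open>?e\<close>, and \<open>M\<close> sends it to \<open>W * T\<close>, of
  squared volume the square of \<open>?e\<close>; hence \<open>?e \<le> c\<close>.\<close>

lemma vol_bound_adjoint:
  assumes M: "M \<in> carrier_mat n n" and k: "k \<le> n" and c: "vol_bound n k M c"
  shows "vol_bound n k (mat_adjoint M) c"
proof -
  define N where "N = M * mat_adjoint M"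
  have aM: "mat_adjoint M \<in> carrier_mat n n"
    using M by simp
  have N: "N \<in> psd_mats n"
    using adjoint_self_psd[OF aM] by (simp add: N_def)
  obtain W T where W: "W \<in> carrier_mat n k" "mat_adjoint W * W = 1\<^sub>m k" "T \<in> carrier_mat k k"
    "N * W = W * T" "det T = complex_of_real (eig_prod k N)"
    using psd_top_eigenvectors[OF N k] by blast
  let ?e = "eig_prod k N"
  have e: "0 \<le> ?e"
    using N k by (rule eig_prod_nonneg)
  have W1: "gram_det W = 1"
    by (simp add: gram_det_def W(2))
  have aMW: "mat_adjoint M * W \<in> carrier_mat n k"
    using aM W by (intro mult_carrier_mat) auto
  have "gram_det (M * (mat_adjoint M * W)) = gram_det (W * T)"
    using M aM W by (simp add: N_def assoc_mult_mat[of _ n n _ n _ k])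
  also have "\<dots> = ?e\<^sup>2"
    using gram_det_mult_right[OF W(1,3)] W1 e by (simp add: W(5))
  finally have 1: "gram_det (M * (mat_adjoint M * W)) = ?e\<^sup>2" .
  have "mat_adjoint (mat_adjoint M * W) * (mat_adjoint M * W) = mat_adjoint W * (W * T)"
    unfolding adjoint_mult_self[OF aM W(1)] mat_adjoint_adjoint N_def[symmetric] W(4) ..
  also have "\<dots> = T"
    using W by (subst assoc_mult_mat[symmetric, of _ k n _ k _ k]) auto
  finally have 2: "gram_det (mat_adjoint M * W) = ?e"
    by (simp add: gram_det_def W(5))
  have "?e\<^sup>2 \<le> c * ?e"
    using c aMW 1 2 by (auto simp: vol_bound_def)
  then have "?e \<le> c"
    using e vol_bound_nonneg[OF M k c] by (cases "?e = 0") (auto simp: power2_eq_square)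
  moreover have "vol_bound n k (mat_adjoint M) ?e"
    using vol_bound_eig_prod[OF aM k] by (simp add: N_def)
  ultimately show ?thesis
    by (rule vol_bound_mono[rotated])
qed

lemma eig_prod_adjoint_swap:
  assumes M: "M \<in> carrier_mat n n" and k: "k \<le> n"
  shows "eig_prod k (mat_adjoint M * M) = eig_prod k (M * mat_adjoint M)"
proof -
  have le: "eig_prod k (M * mat_adjoint M) \<le> eig_prod k (mat_adjoint M * M)" if "M \<in> carrier_mat n n" for M
    using eig_prod_le_vol_bound[OF _ k vol_bound_adjoint[OF that k vol_bound_eig_prod[OF that k]]] that
    by simp
  show ?thesis
    using le[OF M] le[of "mat_adjoint M"] M by simp
qed

section \<open>The Araki--Lieb--Thirring inequality\<close>

text \<open>With \<open>P = Y\<^sup>m X\<^sup>2\<^sup>m Y\<^sup>m\<close> and \<open>L = X\<^sup>s Y\<^sup>s\<^sup>+\<^sup>t X\<^sup>t\<close>, the matrix \<open>X\<^sup>s Y\<^sup>m\<close> intertwines \<open>P\<close> and \<open>L\<close>, so the eigenvalues of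
  \<open>P\<close> are eigenvalues of \<open>L = (X\<^sup>s Y\<^sup>s) (X\<^sup>t Y\<^sup>t)\<^sup>*\<close> and are controlled by its volume bound.\<close>

lemma vol_bound_rpow_midpoint:
  assumes X: "X \<in> psd_mats n" and Y: "Y \<in> psd_mats n" and k: "k \<le> n" and c: "0 < c"
    and s: "vol_bound n k (mat_rpow X s * mat_rpow Y s) (c powr s)"
    and t: "vol_bound n k (mat_rpow X t * mat_rpow Y t) (c powr t)"
  defines "m \<equiv> (s + t) / 2"
  shows "vol_bound n k (mat_rpow X m * mat_rpow Y m) (c powr m)"
proof -
  let ?x = "mat_rpow X" and ?y = "mat_rpow Y"
  have xc: "?x r \<in> carrier_mat n n" "mat_adjoint (?x r) = ?x r"
    and yc: "?y r \<in> carrier_mat n n" "mat_adjoint (?y r) = ?y r" for r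
    using psd_matsD[OF mat_rpow_psd[OF X, of r]] psd_matsD[OF mat_rpow_psd[OF Y, of r]] by auto
  have xx: "?x r * (?x u * Z) = ?x (r + u) * Z" and yy: "?y r * (?y u * Z) = ?y (r + u) * Z"
    if "Z \<in> carrier_mat n l" for r u Z l
    using that xc(1) yc(1) mat_rpow_add[OF X, of r u] mat_rpow_add[OF Y, of r u]
    by (simp_all add: assoc_mult_mat[symmetric, of _ n n _ n _ l])
  define Q where "Q = ?x m * ?y m"
  have Q: "Q \<in> carrier_mat n n"
    using xc yc by (simp add: Q_def)
  define P where "P = mat_adjoint Q * Q"
  have mm: "m + m = s + t"
    by (simp add: m_def)
  have P_eq: "P = ?y m * (?x (s + t) * ?y m)"
    using xc yc mm xx[OF yc(1)]
    by (simp add: P_def Q_def mat_adjoint_mult[of _ n n _ n] assoc_mult_mat[of _ n n _ n _ n])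
  have P: "P \<in> psd_mats n"
    unfolding P_def using Q by (rule adjoint_self_psd)
  obtain W T where W: "W \<in> carrier_mat n k" "mat_adjoint W * W = 1\<^sub>m k" "T \<in> carrier_mat k k"
    "P * W = W * T" "det T = complex_of_real (eig_prod k P)"
    using psd_top_eigenvectors[OF P k] by blast
  let ?e = "eig_prod k P"
  have e: "0 \<le> ?e"
    using P k by (rule eig_prod_nonneg)
  note as = assoc_mult_mat[of _ n n _ n _ n] assoc_mult_mat[of _ n n _ n _ k] mult_carrier_mat[of _ n n _ k]
  define L where "L = ?x s * (?y s * (?y t * ?x t))"
  define V where "V = ?x s * (?y m * W)"
  have V: "V \<in> carrier_mat n k"
    using xc yc W by (simp add: V_def as)
  have "?y t * ?x t = mat_adjoint (?x t * ?y t)"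
    using xc yc by (simp add: mat_adjoint_mult[of _ n n _ n])
  then have "vol_bound n k (?y t * ?x t) (c powr t)"
    using vol_bound_adjoint[OF _ k t] xc yc by simp
  then have "vol_bound n k (?x s * ?y s * (?y t * ?x t)) (c powr s * c powr t)"
    using s xc yc by (intro vol_bound_mult) auto
  then have L: "vol_bound n k L (c powr m * c powr m)"
    using xc yc mm by (simp add: L_def as flip: powr_add)
  have "L * V = ?x s * (?y m * (P * W))"
  proof -
    have "L * V = ?x s * (?y (s + t) * (?x (s + t) * (?y m * W)))"
      using xc yc W by (simp add: L_def V_def as xx[of _ k] yy[of _ k] yy[of _ n] add.commute)
    also have "\<dots> = ?x s * (?y m * (P * W))"
      using xc yc W(1) by (simp add: P_eq as yy[of _ k] mm)
    finally show ?thesis .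
  qed
  also have "\<dots> = V * T"
    unfolding W(4) using xc yc W
    by (simp add: V_def as assoc_mult_mat[of _ n n _ k _ k])
  finally have "gram_det (L * V) = ?e\<^sup>2 * gram_det V"
    using gram_det_mult_right[OF V W(3)] e by (simp add: W(5))
  moreover have "gram_det (L * V) \<le> c powr m * c powr m * gram_det V"
    using L V by (simp add: vol_bound_def)
  ultimately have le: "?e\<^sup>2 * gram_det V \<le> (c powr m)\<^sup>2 * gram_det V"
    by (simp add: power2_eq_square)
  have "?e \<le> c powr m"
  proof (cases "?e = 0")
    case False
    \<comment> \<open>Dividing by \<open>gram_det V\<close> requires that \<open>V\<close> has not
      collapsed, which singular \<open>X\<close> or \<open>Y\<close> could cause. But
      \<open>R\<close> maps \<open>V\<close> to \<open>W * T\<close>, whose volume is nonzero, so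
      \<open>V\<close> has nonzero volume.\<close>
    define R where "R = ?y m * ?x t"
    have R: "R \<in> carrier_mat n n"
      using xc yc by (simp add: R_def)
    have "R * V = W * T"
      unfolding W(4)[symmetric] P_eq using xc yc W
      by (simp add: R_def V_def as xx[of _ k] add.commute)
    then have "gram_det (R * V) = ?e\<^sup>2 * gram_det W"
      using gram_det_mult_right[OF W(1,3)] e by (simp add: W(5))
    moreover have "gram_det W = 1"
      by (simp add: gram_det_def W(2))
    moreover have "gram_det (R * V) \<le> eig_prod k (mat_adjoint R * R) * gram_det V"
      using vol_bound_eig_prod[OF R k] V by (simp add: vol_bound_def)
    ultimately have "gram_det V \<noteq> 0"
      using False by auto
    then have "0 < gram_det V"
      using gram_det_nonneg[OF V] by simp
    then have "?e\<^sup>2 \<le> (c powr m)\<^sup>2"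
      using le by simp
    then show ?thesis
      by (rule power2_le_imp_le) simp
  qed simp
  then show ?thesis
    using vol_bound_mono[OF vol_bound_eig_prod[OF Q k]] by (simp add: P_def Q_def)
qed

text \<open>The zeroth power is the support projection, which is in general not the identity; being
  a projection it does not increase volumes.\<close>

lemma vol_bound_rpow_0:
  assumes X: "X \<in> psd_mats n" and k: "k \<le> n"
  shows "vol_bound n k (mat_rpow X 0) 1"
proof -
  have X0: "mat_rpow X 0 \<in> psd_mats n"
    using X by (rule mat_rpow_psd)
  have "mat_adjoint (mat_rpow X 0) * mat_rpow X 0 = mat_rpow X 0"
    using psd_matsD(2)[OF X0] mat_rpow_add[OF X, of 0 0] by simp
  moreover have "eig_prod k (mat_rpow X 0) \<le> 1"
    using eig_prod_rpow[OF X k, of 0] by simp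
  ultimately show ?thesis
    using vol_bound_mono[OF vol_bound_eig_prod[OF psd_matsD(1)[OF X0] k]] by simp
qed

text \<open>Exponents 0 and 1 start the induction. On each new level an odd numerator is the
  midpoint of two neighbours from the previous level, and an even one already occurs there.\<close>

lemma vol_bound_rpow_dyadic:
  fixes m :: nat
  assumes X: "X \<in> psd_mats n" and Y: "Y \<in> psd_mats n" and k: "k \<le> n" and c: "0 < c"
    and 1: "vol_bound n k (X * Y) c" and "m \<le> 2 ^ j"
  shows "vol_bound n k (mat_rpow X (m / 2 ^ j) * mat_rpow Y (m / 2 ^ j)) (c powr (m / 2 ^ j))"
  using \<open>m \<le> 2 ^ j\<close>
proof (induction j arbitrary: m)
  case 0
  then consider "m = 0" | "m = 1" by fastforce
  then show ?case
  proof cases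
    case 1
    have "vol_bound n k (mat_rpow X 0 * mat_rpow Y 0) (1 * 1)"
      using vol_bound_rpow_0[OF X k] vol_bound_rpow_0[OF Y k]
        psd_matsD(1)[OF mat_rpow_psd[OF X]] psd_matsD(1)[OF mat_rpow_psd[OF Y]]
      by (intro vol_bound_mult) auto
    then show ?thesis
      using 1 c by simp
  next
    case 2
    then show ?thesis
      using 1 c mat_rpow_one[OF X] mat_rpow_one[OF Y] by simp
  qed
next
  case (Suc j)
  show ?case
  proof (cases "even m")
    case True
    then obtain a where a: "m = 2 * a" by blast
    then have "real m / 2 ^ Suc j = real a / 2 ^ j"
      by simp
    then show ?thesis
      using Suc.IH[of a] Suc.prems a by (simp only:) simp
  next
    case False
    then obtain a where a: "m = 2 * a + 1"
      by (rule oddE)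
    then have "real m / 2 ^ Suc j = (real a / 2 ^ j + real (Suc a) / 2 ^ j) / 2"
      by (simp add: field_simps)
    moreover have "a \<le> 2 ^ j" "Suc a \<le> 2 ^ j"
      using Suc.prems a by auto
    ultimately show ?thesis
      using vol_bound_rpow_midpoint[OF X Y k c Suc.IH Suc.IH, of a "Suc a"] by (simp only:)
  qed
qed

section \<open>Entrywise limits: from dyadic to real exponents\<close>

lemma tendsto_det:
  fixes A :: "'b \<Rightarrow> complex mat"
  assumes "\<And>l. A l \<in> carrier_mat k k" "B \<in> carrier_mat k k"
    and "\<And>i j. i < k \<Longrightarrow> j < k \<Longrightarrow> ((\<lambda>l. A l $$ (i, j)) \<longlongrightarrow> B $$ (i, j)) F"
  shows "((\<lambda>l. det (A l)) \<longlongrightarrow> det B) F"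
  unfolding det_def'[OF assms(1)] det_def'[OF assms(2)]
  by (intro tendsto_intros assms(3)) (auto simp: permutes_in_image)

lemma tendsto_mat_mult:
  fixes A B :: "'b \<Rightarrow> complex mat"
  assumes "\<And>l. A l \<in> carrier_mat n m" "A' \<in> carrier_mat n m" "\<And>l. B l \<in> carrier_mat m k" "B' \<in> carrier_mat m k"
    and "\<And>i j. i < n \<Longrightarrow> j < m \<Longrightarrow> ((\<lambda>l. A l $$ (i, j)) \<longlongrightarrow> A' $$ (i, j)) F"
    and "\<And>i j. i < m \<Longrightarrow> j < k \<Longrightarrow> ((\<lambda>l. B l $$ (i, j)) \<longlongrightarrow> B' $$ (i, j)) F"
    and "i < n" "j < k"
  shows "((\<lambda>l. (A l * B l) $$ (i, j)) \<longlongrightarrow> (A' * B') $$ (i, j)) F"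
proof -
  have "(A l * B l) $$ (i, j) = (\<Sum>r<m. A l $$ (i, r) * B l $$ (r, j))" for l
    using assms(1)[of l] assms(3)[of l] assms(7,8) by (simp add: scalar_prod_def lessThan_atLeast0)
  moreover have "(A' * B') $$ (i, j) = (\<Sum>r<m. A' $$ (i, r) * B' $$ (r, j))"
    using assms(2,4,7,8) by (simp add: scalar_prod_def lessThan_atLeast0)
  moreover have "((\<lambda>l. \<Sum>r<m. A l $$ (i, r) * B l $$ (r, j)) \<longlongrightarrow> (\<Sum>r<m. A' $$ (i, r) * B' $$ (r, j))) F"
    using assms(7,8) by (intro tendsto_intros assms(5,6)) auto
  ultimately show ?thesis by simp
qed

text \<open>For fixed \<open>Z\<close> both sides are continuous in the exponent. This holds for
  singular \<open>X\<close> and \<open>Y\<close>, even at exponent 0, since \<open>0 powr r\<close>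
  is constantly 0.\<close>

lemma vol_bound_rpow:
  assumes X: "X \<in> psd_mats n" and Y: "Y \<in> psd_mats n" and k: "k \<le> n" and c: "0 < c"
    and 1: "vol_bound n k (X * Y) c" and s: "0 \<le> s" "s \<le> 1"
  shows "vol_bound n k (mat_rpow X s * mat_rpow Y s) (c powr s)"
  unfolding vol_bound_def
proof
  fix Z :: "complex mat" assume Z: "Z \<in> carrier_mat n k"
  define \<sigma> where "\<sigma> j = real (nat \<lfloor>2 ^ j * s\<rfloor>) / 2 ^ j" for j :: nat
  have fl: "real (nat \<lfloor>2 ^ j * s\<rfloor>) = of_int \<lfloor>2 ^ j * s\<rfloor>" for j
    using s by simp
  have bound: "s - (1/2) ^ j \<le> \<sigma> j" "\<sigma> j \<le> s" for j
  proof -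
    have "s - (1/2) ^ j = (2 ^ j * s - 1) / 2 ^ j" "s = 2 ^ j * s / 2 ^ j"
      by (simp_all add: field_simps power_divide)
    moreover have "2 ^ j * s - 1 \<le> of_int \<lfloor>2 ^ j * s\<rfloor>" "of_int \<lfloor>2 ^ j * s\<rfloor> \<le> 2 ^ j * s"
      by linarith+
    ultimately show "s - (1/2) ^ j \<le> \<sigma> j" "\<sigma> j \<le> s"
      unfolding \<sigma>_def fl by (metis divide_right_mono zero_le_numeral zero_le_power)+
  qed
  have "(\<lambda>j. s - (1/2) ^ j) \<longlonglongrightarrow> s - 0"
    by (intro tendsto_intros LIMSEQ_power_zero) simp
  then have \<sigma>: "\<sigma> \<longlonglongrightarrow> s"
    using bound by (intro real_tendsto_sandwich[of "\<lambda>j. s - (1/2) ^ j" \<sigma> _ "\<lambda>_. s"]) auto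
  let ?M = "\<lambda>r. mat_rpow X r * mat_rpow Y r"
  have xc: "mat_rpow X r \<in> carrier_mat n n" and yc: "mat_rpow Y r \<in> carrier_mat n n" for r
    using psd_matsD[OF mat_rpow_psd[OF X, of r]] psd_matsD[OF mat_rpow_psd[OF Y, of r]] by auto
  have Mc: "?M r \<in> carrier_mat n n" for r
    using xc yc by simp
  have MZc: "?M r * Z \<in> carrier_mat n k" for r
    using Mc Z by (rule mult_carrier_mat)
  have "gram_det (?M (\<sigma> j) * Z) \<le> c powr \<sigma> j * gram_det Z" for j
  proof -
    have "real (nat \<lfloor>2 ^ j * s\<rfloor>) \<le> 2 ^ j * s"
      unfolding fl by (rule of_int_floor_le)
    also have "\<dots> \<le> real (2 ^ j)"
      using s by simp
    finally have "nat \<lfloor>2 ^ j * s\<rfloor> \<le> 2 ^ j"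
      by (simp only: of_nat_le_iff)
    from vol_bound_rpow_dyadic[OF X Y k c 1 this] Z show ?thesis
      by (simp add: vol_bound_def \<sigma>_def)
  qed
  moreover have "(\<lambda>j. gram_det (?M (\<sigma> j) * Z)) \<longlonglongrightarrow> gram_det (?M s * Z)"
  proof -
    have "(\<lambda>l. ?M (\<sigma> l) $$ (i, j)) \<longlonglongrightarrow> ?M s $$ (i, j)" if "i < n" "j < n" for i j
      by (rule tendsto_mat_mult[OF xc xc yc yc tendsto_mat_rpow[OF X \<sigma>] tendsto_mat_rpow[OF Y \<sigma>] that]) auto
    then have lim: "(\<lambda>l. (?M (\<sigma> l) * Z) $$ (i, j)) \<longlonglongrightarrow> (?M s * Z) $$ (i, j)" if "i < n" "j < k" for i j
      using that by (intro tendsto_mat_mult[OF Mc Mc Z Z]) auto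
    have lim': "(\<lambda>l. mat_adjoint (?M (\<sigma> l) * Z) $$ (i, j)) \<longlonglongrightarrow> mat_adjoint (?M s * Z) $$ (i, j)"
      if "i < k" "j < n" for i j
    proof -
      have "mat_adjoint (?M r * Z) $$ (i, j) = cnj ((?M r * Z) $$ (j, i))" for r
        using MZc[of r] that by (subst mat_adjoint_index) auto
      then show ?thesis
        using lim[OF that(2,1)] by (simp only: tendsto_cnj)
    qed
    have c: "mat_adjoint (?M r * Z) * (?M r * Z) \<in> carrier_mat k k" for r
      by (rule mult_carrier_mat[of _ k n]) (use MZc in \<open>simp_all del: index_mult_mat\<close>)
    have a: "mat_adjoint (?M r * Z) \<in> carrier_mat k n" for r
      using MZc by simp
    show ?thesis
      unfolding gram_det_def
      by (intro tendsto_Re tendsto_det[OF c c] tendsto_mat_mult[OF a a MZc MZc] lim lim') auto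
  qed
  moreover have "(\<lambda>j. c powr \<sigma> j * gram_det Z) \<longlonglongrightarrow> c powr s * gram_det Z"
    using c \<sigma> by (intro tendsto_intros tendsto_powr_exponent) auto
  ultimately show "gram_det (?M s * Z) \<le> c powr s * gram_det Z"
    by (intro LIMSEQ_le) auto
qed

text \<open>With inner exponent \<open>2 * s\<close> the sandwich is
  \<open>mat_adjoint M * M\<close> for \<open>M = mat_rpow Y s * mat_rpow X s\<close>, so its
  eigenvalue products are the least volume bounds of \<open>M\<close>.\<close>

theorem araki_lieb_thirring:
  assumes X: "X \<in> psd_mats n" and Y: "Y \<in> psd_mats n" and k: "k \<le> n" and s: "0 < s" "s \<le> 1"
  shows "eig_prod k (mat_rpow X s * mat_rpow Y (2 * s) * mat_rpow X s) \<le>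
    eig_prod k (X * mat_rpow Y 2 * X) powr s"
proof -
  have xc: "mat_rpow X r \<in> carrier_mat n n" "mat_adjoint (mat_rpow X r) = mat_rpow X r"
    and yc: "mat_rpow Y r \<in> carrier_mat n n" "mat_adjoint (mat_rpow Y r) = mat_rpow Y r" for r
    using psd_matsD[OF mat_rpow_psd[OF X, of r]] psd_matsD[OF mat_rpow_psd[OF Y, of r]] by auto
  have sq: "mat_rpow X r * mat_rpow Y (2 * r) * mat_rpow X r =
      mat_adjoint (mat_rpow Y r * mat_rpow X r) * (mat_rpow Y r * mat_rpow X r)" for r
  proof -
    have "mat_rpow Y r * (mat_rpow Y r * mat_rpow X r) = mat_rpow Y (2 * r) * mat_rpow X r"
      using xc yc mat_rpow_add[OF Y, of r r] by (simp flip: assoc_mult_mat[of _ n n _ n _ n])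
    then show ?thesis
      using xc yc by (simp add: mat_adjoint_mult[of _ n n _ n] assoc_mult_mat[of _ n n _ n _ n])
  qed
  have c: "mat_rpow Y r * mat_rpow X r \<in> carrier_mat n n" for r
    using xc yc by simp
  define h where "h = eig_prod k (X * mat_rpow Y 2 * X)"
  have h1: "h = eig_prod k (mat_adjoint (Y * X) * (Y * X))"
    using sq[of 1] mat_rpow_one[OF X] mat_rpow_one[OF Y] by (simp add: h_def)
  have YX: "Y * X \<in> carrier_mat n n"
    using psd_matsD(1)[OF X] psd_matsD(1)[OF Y] by simp
  have h0: "0 \<le> h"
    unfolding h1 using adjoint_self_psd[OF YX] k by (rule eig_prod_nonneg)
  let ?l = "eig_prod k (mat_rpow X s * mat_rpow Y (2 * s) * mat_rpow X s)"
  \<comment> \<open>\<open>h\<close> may be 0 while \<open>vol_bound_rpow\<close> needs a positive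
    bound, so \<open>h\<close> is enlarged slightly and the excess sent to 0.\<close>
  have "?l \<le> (h + 1 / real (Suc j)) powr s" for j
  proof -
    have "vol_bound n k (Y * X) (h + 1 / real (Suc j))"
      by (rule vol_bound_mono[OF vol_bound_eig_prod[OF YX k]]) (simp add: h1)
    then have "vol_bound n k (mat_rpow Y s * mat_rpow X s) ((h + 1 / real (Suc j)) powr s)"
      using s h0 by (intro vol_bound_rpow[OF Y X k]) (auto intro: add_nonneg_pos)
    then show ?thesis
      unfolding sq by (rule eig_prod_le_vol_bound[OF c k])
  qed
  moreover have "(\<lambda>j. (h + 1 / real (Suc j)) powr s) \<longlonglongrightarrow> (h + 0) powr s"
    using s h0 by (intro tendsto_powr' tendsto_intros LIMSEQ_Suc[OF lim_1_over_n]) (auto intro!: always_eventually)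
  ultimately show ?thesis
    unfolding h_def[symmetric] by (intro LIMSEQ_le_const) auto
qed

section \<open>Log-majorization of the Renyi mean\<close>

lemma mat_rpow_sandwich_psd:
  assumes "A \<in> psd_mats n" "Z \<in> psd_mats n"
  shows "mat_rpow A r * Z * mat_rpow A r \<in> psd_mats n"
  using assms by (intro psd_congruence_hermitian mat_rpow_psd)

lemma mat_rpow_sandwich_sandwich:
  assumes A: "A \<in> psd_mats n" and Z: "Z \<in> carrier_mat n n"
  shows "mat_rpow A r * (mat_rpow A s * Z * mat_rpow A s) * mat_rpow A r =
    mat_rpow A (r + s) * Z * mat_rpow A (r + s)"
proof -
  have c: "mat_rpow A t \<in> carrier_mat n n" for t
    using psd_matsD(1)[OF mat_rpow_psd[OF A]] .
  have "mat_rpow A r * (mat_rpow A s * Z * mat_rpow A s) * mat_rpow A r =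
      (mat_rpow A r * mat_rpow A s) * (Z * (mat_rpow A s * mat_rpow A r))"
    using c Z by (simp add: assoc_mult_mat[of _ n n _ n _ n])
  also have "\<dots> = mat_rpow A (r + s) * (Z * mat_rpow A (s + r))"
    by (simp only: mat_rpow_add[OF A])
  finally show ?thesis
    using c Z by (simp add: assoc_mult_mat[of _ n n _ n _ n] add.commute)
qed

lemma renyi_mean_psd:
  assumes "A \<in> psd_mats n" "B \<in> psd_mats n"
  shows "renyi_mean \<alpha> q A B \<in> psd_mats n"
  unfolding renyi_mean_def using assms by (intro mat_rpow_psd mat_rpow_sandwich_psd)

lemma eig_prod_renyi_mean:
  assumes "A \<in> psd_mats n" "B \<in> psd_mats n" "k \<le> n" "0 < q"
  shows "eig_prod k (renyi_mean \<alpha> q A B) =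
    eig_prod k (mat_rpow A ((1 - \<alpha>) / 2 * q) * mat_rpow B (\<alpha> * q) * mat_rpow A ((1 - \<alpha>) / 2 * q)) powr (1 / q)"
  unfolding renyi_mean_def using assms
  by (intro eig_prod_rpow[of _ n] mat_rpow_sandwich_psd mat_rpow_psd) auto

text \<open>\<open>SG_core\<close> has the same eigenvalues as the \<open>p\<close>-th power of \<open>SG_tilde\<close>: they arise as \<open>N\<^sup>*N\<close> and \<open>NN\<^sup>*\<close>.\<close>

definition SG_core :: "real \<Rightarrow> real \<Rightarrow> complex mat \<Rightarrow> complex mat \<Rightarrow> complex mat" where
  "SG_core \<alpha> p A B = mat_rpow A ((1/2 - \<alpha>) * p) *
     mat_rpow (mat_rpow A (p/2) * mat_rpow B p * mat_rpow A (p/2)) \<alpha> * mat_rpow A ((1/2 - \<alpha>) * p)"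

lemma SG_core_psd:
  assumes "A \<in> psd_mats n" "B \<in> psd_mats n"
  shows "SG_core \<alpha> p A B \<in> psd_mats n"
  unfolding SG_core_def using assms by (intro mat_rpow_psd mat_rpow_sandwich_psd)

text \<open>\<open>N\<close> takes half of the middle power of \<open>A\<close>, which gives
  \<open>N * mat_adjoint N\<close> inside \<open>SG_tilde\<close>. In the opposite product the two
  square roots of \<open>G\<close> merge, and the outer exponents add up to (1 - \<alpha>)p - p/2 =
  (1/2 - \<alpha>)p. \<open>eig_prod_adjoint_swap\<close> transfers the eigenvalue products.\<close>

lemma
  assumes A: "A \<in> psd_mats n" and B: "B \<in> psd_mats n" and p: "0 < p"
  shows SG_tilde_psd: "SG_tilde \<alpha> p A B \<in> psd_mats n"
    and eig_prod_SG_tilde: "k \<le> n \<Longrightarrow>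
      eig_prod k (SG_tilde \<alpha> p A B) = eig_prod k (SG_core \<alpha> p A B) powr (1 / p)"
proof -
  define C where "C = mat_rpow A (p/2) * mat_rpow B p * mat_rpow A (p/2)"
  have C: "C \<in> psd_mats n"
    unfolding C_def using A B by (intro mat_rpow_psd mat_rpow_sandwich_psd)
  define G where "G = gmean \<alpha> (mat_rpow A (- p)) (mat_rpow B p)"
  have G_eq: "G = mat_rpow A (- p/2) * mat_rpow C \<alpha> * mat_rpow A (- p/2)"
    unfolding G_def gmean_def C_def mat_rpow_rpow[OF A] by simp
  have G: "G \<in> psd_mats n"
    unfolding G_eq using A C by (intro mat_rpow_psd mat_rpow_sandwich_psd)
  define N where "N = mat_rpow G (1/2) * mat_rpow A ((1 - \<alpha>) * p)"
  note g = psd_matsD[OF mat_rpow_psd[OF G, of "1/2"]]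
  have a: "mat_rpow A t \<in> carrier_mat n n" "mat_adjoint (mat_rpow A t) = mat_rpow A t" for t
    using psd_matsD[OF mat_rpow_psd[OF A]] by auto
  have N: "N \<in> carrier_mat n n"
    unfolding N_def using g a by simp
  have aN: "mat_adjoint N = mat_rpow A ((1 - \<alpha>) * p) * mat_rpow G (1/2)"
    unfolding N_def using g a by (simp add: mat_adjoint_mult[of _ n n _ n])
  have "N * mat_adjoint N = mat_rpow G (1/2) *
      ((mat_rpow A ((1 - \<alpha>) * p) * mat_rpow A ((1 - \<alpha>) * p)) * mat_rpow G (1/2))"
    unfolding aN unfolding N_def using g a by (simp add: assoc_mult_mat[of _ n n _ n _ n])
  also have "mat_rpow A ((1 - \<alpha>) * p) * mat_rpow A ((1 - \<alpha>) * p) = mat_rpow A (2 * (1 - \<alpha>) * p)"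
    unfolding mat_rpow_add[OF A] by (simp add: algebra_simps)
  finally have NN: "SG_tilde \<alpha> p A B = mat_rpow (N * mat_adjoint N) (1 / p)"
    using g a by (simp add: SG_tilde_def G_def assoc_mult_mat[of _ n n _ n _ n])
  have "mat_adjoint N * N = mat_rpow A ((1 - \<alpha>) * p) *
      ((mat_rpow G (1/2) * mat_rpow G (1/2)) * mat_rpow A ((1 - \<alpha>) * p))"
    unfolding aN unfolding N_def using g a by (simp add: assoc_mult_mat[of _ n n _ n _ n])
  also have "mat_rpow G (1/2) * mat_rpow G (1/2) = G"
    unfolding mat_rpow_add[OF G] using mat_rpow_one[OF G] by simp
  also have "mat_rpow A ((1 - \<alpha>) * p) * (G * mat_rpow A ((1 - \<alpha>) * p)) =
      mat_rpow A ((1 - \<alpha>) * p) * G * mat_rpow A ((1 - \<alpha>) * p)"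
    using a psd_matsD(1)[OF G] by (intro assoc_mult_mat[symmetric]) auto
  also have "\<dots> = SG_core \<alpha> p A B"
    unfolding G_eq mat_rpow_sandwich_sandwich[OF A psd_matsD(1)[OF mat_rpow_psd[OF C]]]
    by (simp add: SG_core_def C_def algebra_simps)
  finally have core: "mat_adjoint N * N = SG_core \<alpha> p A B" .
  have P: "N * mat_adjoint N \<in> psd_mats n"
    using adjoint_self_psd[of "mat_adjoint N" n n] N by simp
  then show "SG_tilde \<alpha> p A B \<in> psd_mats n"
    unfolding NN by (rule mat_rpow_psd)
  assume k: "k \<le> n"
  show "eig_prod k (SG_tilde \<alpha> p A B) = eig_prod k (SG_core \<alpha> p A B) powr (1 / p)"
    unfolding NN core[symmetric] eig_prod_adjoint_swap[OF N k]
    using P k p by (intro eig_prod_rpow) auto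
qed

text \<open>Two applications of the Araki--Lieb--Thirring inequality: with exponent \<open>\<alpha>q/p\<close> it leads from the
  Renyi mean with parameter \<open>q\<close> to the one with parameter \<open>p/\<alpha>\<close>, which by \<open>C = A\<^sup>p\<^sup>/\<^sup>2 B\<^sup>p A\<^sup>p\<^sup>/\<^sup>2\<close> is compared
  with \<open>SG_core\<close> using exponent \<open>1/\<alpha>\<close>.\<close>

lemma eig_prod_renyi_le_SG:
  assumes A: "A \<in> psd_mats n" and B: "B \<in> psd_mats n" and k: "k \<le> n"
    and \<alpha>: "1 < \<alpha>" and p: "0 < p" and q: "0 < q" and pq: "\<alpha> \<le> p / q"
  shows "eig_prod k (renyi_mean \<alpha> q A B) \<le> eig_prod k (SG_tilde \<alpha> p A B)"
proof -
  define C where "C = mat_rpow A (p/2) * mat_rpow B p * mat_rpow A (p/2)"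
  have C: "C \<in> psd_mats n"
    unfolding C_def using A B by (intro mat_rpow_psd mat_rpow_sandwich_psd)
  have core: "SG_core \<alpha> p A B = mat_rpow A ((1/2 - \<alpha>) * p) * mat_rpow C \<alpha> * mat_rpow A ((1/2 - \<alpha>) * p)"
    by (simp add: SG_core_def C_def)
  \<comment> \<open>\<open>x\<close> is the outer exponent of the Renyi mean with parameter
    p/\<alpha>, and \<open>y\<close> is the outer exponent of \<open>SG_core\<close> divided by
    \<alpha>. They differ by p/2, which \<open>C\<close> absorbs.\<close>
  define x where "x = (1 - \<alpha>) * p / (2 * \<alpha>)"
  define y where "y = (1/2 - \<alpha>) * p / \<alpha>"
  let ?E1 = "eig_prod k (mat_rpow A ((1 - \<alpha>) / 2 * q) * mat_rpow B (\<alpha> * q) * mat_rpow A ((1 - \<alpha>) / 2 * q))"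
  let ?E2 = "eig_prod k (mat_rpow A x * mat_rpow B p * mat_rpow A x)"
  let ?E3 = "eig_prod k (SG_core \<alpha> p A B)"
  have E1: "0 \<le> ?E1" and E2: "0 \<le> ?E2" and E3: "0 \<le> ?E3"
    using A B k by (auto intro!: eig_prod_nonneg[of _ n] mat_rpow_sandwich_psd mat_rpow_psd SG_core_psd)
  have "?E1 \<le> ?E2 powr (\<alpha> * q / p)"
  proof -
    \<comment> \<open>The hypothesis p/q \<ge> \<alpha> enters here: the exponent must be at most
      1.\<close>
    have s: "0 < \<alpha> * q / p" "\<alpha> * q / p \<le> 1"
      using \<alpha> p q pq by (auto simp: field_simps)
    have eqs: "x * (\<alpha> * q / p) = (1 - \<alpha>) / 2 * q" "p / 2 * (2 * (\<alpha> * q / p)) = \<alpha> * q" "p / 2 * 2 = p"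
      using \<alpha> p by (simp_all add: x_def)
    show ?thesis
      using araki_lieb_thirring[OF mat_rpow_psd[OF A] mat_rpow_psd[OF B] k s, of x "p/2"]
      unfolding mat_rpow_rpow[OF A] mat_rpow_rpow[OF B] eqs .
  qed
  moreover have "?E2 \<le> ?E3 powr (1 / \<alpha>)"
  proof -
    have s: "0 < 1 / \<alpha>" "1 / \<alpha> \<le> 1"
      using \<alpha> by auto
    have "x = y + p / 2"
      using \<alpha> by (simp add: x_def y_def field_simps)
    then have "mat_rpow A x * mat_rpow B p * mat_rpow A x = mat_rpow A y * C * mat_rpow A y"
      unfolding C_def using mat_rpow_sandwich_sandwich[OF A psd_matsD(1)[OF mat_rpow_psd[OF B]]] by simp
    moreover have eqs: "(1/2 - \<alpha>) * p * (1 / \<alpha>) = y" "\<alpha> / 2 * (2 * (1 / \<alpha>)) = 1" "\<alpha> / 2 * 2 = \<alpha>"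
      using \<alpha> by (simp_all add: y_def)
    ultimately show ?thesis
      using araki_lieb_thirring[OF mat_rpow_psd[OF A] mat_rpow_psd[OF C] k s, of "(1/2 - \<alpha>) * p" "\<alpha>/2"]
      unfolding mat_rpow_rpow[OF A] mat_rpow_rpow[OF C] eqs mat_rpow_one[OF C] core by simp
  qed
  ultimately have "?E1 \<le> (?E3 powr (1 / \<alpha>)) powr (\<alpha> * q / p)"
    using \<alpha> p q E2 by (elim order_trans) (intro powr_mono2, auto)
  then have "?E1 powr (1 / q) \<le> ((?E3 powr (1 / \<alpha>)) powr (\<alpha> * q / p)) powr (1 / q)"
    using q E1 by (intro powr_mono2) auto
  also have "\<dots> = ?E3 powr (1 / p)"
    using \<alpha> p q by (simp add: powr_powr)
  finally show ?thesis
    unfolding eig_prod_renyi_mean[OF A B k q] eig_prod_SG_tilde[OF A B p k] .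
qed

section \<open>Equality of the products of all eigenvalues\<close>

lemma eig_prod_full_sandwich:
  assumes A: "A \<in> psd_mats n" and Z: "Z \<in> psd_mats n"
  shows "eig_prod n (mat_rpow A r * Z * mat_rpow A r) = eig_prod n A powr (2 * r) * eig_prod n Z"
proof -
  have "complex_of_real (eig_prod n (mat_rpow A r * Z * mat_rpow A r)) = det (mat_rpow A r * Z * mat_rpow A r)"
    using det_psd[OF mat_rpow_sandwich_psd[OF A Z]] by simp
  also have "\<dots> = det (mat_rpow A r) * det Z * det (mat_rpow A r)"
    using psd_matsD(1)[OF mat_rpow_psd[OF A]] psd_matsD(1)[OF Z] by (simp add: det_mult[of _ n])
  also have "\<dots> = complex_of_real (eig_prod n A powr r * eig_prod n Z * eig_prod n A powr r)"
    unfolding det_mat_rpow[OF A] det_psd[OF Z] by simp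
  also have "eig_prod n A powr r * eig_prod n Z * eig_prod n A powr r = eig_prod n A powr (r + r) * eig_prod n Z"
    by (simp flip: powr_add)
  finally show ?thesis
    by (simp only: of_real_eq_iff mult_2)
qed

text \<open>By multiplicativity of the determinant both sides equal
  \<open>?a powr (1 - \<alpha>) * ?b powr \<alpha>\<close>; for singular \<open>A\<close> both
  vanish because of \<open>0 powr r = 0\<close>.\<close>

lemma eig_prod_full_renyi_eq_SG:
  assumes A: "A \<in> psd_mats n" and B: "B \<in> psd_mats n" and p: "0 < p" and q: "0 < q" and \<alpha>: "0 < \<alpha>"
  shows "eig_prod n (renyi_mean \<alpha> q A B) = eig_prod n (SG_tilde \<alpha> p A B)"
proof -
  let ?a = "eig_prod n A" and ?b = "eig_prod n B"
  have ab: "0 \<le> ?a" "0 \<le> ?b"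
    using A B by (auto intro: eig_prod_nonneg)
  have BP: "mat_rpow B r \<in> psd_mats n" for r
    using B by (rule mat_rpow_psd)
  have C: "mat_rpow A (p/2) * mat_rpow B p * mat_rpow A (p/2) \<in> psd_mats n"
    using A BP by (rule mat_rpow_sandwich_psd)
  have "eig_prod n (renyi_mean \<alpha> q A B) = (?a powr (2 * ((1 - \<alpha>) / 2 * q)) * ?b powr (\<alpha> * q)) powr (1 / q)"
    unfolding eig_prod_renyi_mean[OF A B order_refl q] eig_prod_full_sandwich[OF A BP]
    using eig_prod_rpow[OF B order_refl] \<alpha> q by simp
  also have "\<dots> = ?a powr (1 - \<alpha>) * ?b powr \<alpha>"
    using q by (simp add: powr_mult powr_powr)
  finally have 1: "eig_prod n (renyi_mean \<alpha> q A B) = ?a powr (1 - \<alpha>) * ?b powr \<alpha>" .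
  have "eig_prod n (SG_core \<alpha> p A B) =
    ?a powr (2 * ((1/2 - \<alpha>) * p)) * (?a powr (2 * (p / 2)) * ?b powr p) powr \<alpha>"
    unfolding SG_core_def eig_prod_full_sandwich[OF A mat_rpow_psd[OF C]]
    using eig_prod_rpow[OF C order_refl, of \<alpha>] eig_prod_rpow[OF B order_refl, of p] \<alpha> p
    by (simp add: eig_prod_full_sandwich[OF A BP])
  also have "\<dots> = ?a powr (2 * ((1/2 - \<alpha>) * p) + p * \<alpha>) * ?b powr (p * \<alpha>)"
    by (simp add: powr_mult powr_powr powr_add)
  also have "2 * ((1/2 - \<alpha>) * p) + p * \<alpha> = (1 - \<alpha>) * p"
    by (simp add: algebra_simps)
  finally have "eig_prod n (SG_tilde \<alpha> p A B) = (?a powr ((1 - \<alpha>) * p) * ?b powr (p * \<alpha>)) powr (1 / p)"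
    unfolding eig_prod_SG_tilde[OF A B p order_refl] by simp
  also have "\<dots> = ?a powr (1 - \<alpha>) * ?b powr \<alpha>"
    using p by (simp add: powr_mult powr_powr)
  finally show ?thesis
    using 1 by simp
qed

lemma log_majorized_iff_eig_prod:
  "dim_row X = n \<Longrightarrow> X \<prec>\<^sub>l\<^sub>o\<^sub>g Y \<longleftrightarrow>
    (\<forall>k\<in>{1..n}. eig_prod k X \<le> eig_prod k Y) \<and> eig_prod n X = eig_prod n Y"
  by (simp add: log_majorized_def eig_prod_def)

lemma renyi_log_majorized_SG:
  assumes "A \<in> psd_mats n" "B \<in> psd_mats n" "1 < \<alpha>" "0 < p" "0 < q" "\<alpha> \<le> p / q"
  shows "renyi_mean \<alpha> q A B \<prec>\<^sub>l\<^sub>o\<^sub>g SG_tilde \<alpha> p A B"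
  unfolding log_majorized_iff_eig_prod[OF psd_matsD(3)[OF renyi_mean_psd[OF assms(1,2)]]]
  using assms eig_prod_renyi_le_SG[of A n B] eig_prod_full_renyi_eq_SG[of A n B] by auto

section \<open>Counterexamples in dimension two\<close>

lemma unitary_row_col_norm:
  assumes U: "U \<in> unitary_mats n" and i: "i < n"
  shows "(\<Sum>l<n. (cmod (U $$ (i, l)))\<^sup>2) = 1" "(\<Sum>l<n. (cmod (U $$ (l, i)))\<^sup>2) = 1"
proof -
  note u = unitaryD[OF U]
  have "complex_of_real (\<Sum>l<n. (cmod (U $$ (i, l)))\<^sup>2) = (U * mat_adjoint U) $$ (i, i)"
    using u(1) i by (simp add: scalar_prod_def lessThan_atLeast0 complex_norm_square del: of_real_power)
  then show "(\<Sum>l<n. (cmod (U $$ (i, l)))\<^sup>2) = 1"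
    unfolding u(3) using i by (simp del: of_real_sum of_real_power)
  have "complex_of_real (\<Sum>l<n. (cmod (U $$ (l, i)))\<^sup>2) = (mat_adjoint U * U) $$ (i, i)"
    using u(1) i by (simp add: scalar_prod_def lessThan_atLeast0 complex_norm_square mult.commute del: of_real_power)
  then show "(\<Sum>l<n. (cmod (U $$ (l, i)))\<^sup>2) = 1"
    unfolding u(2) using i by (simp del: of_real_sum of_real_power)
qed

lemma Re_spec_mat_diag:
  assumes "U \<in> unitary_mats n" "i < n"
  shows "Re (spec_mat n U d $$ (i, i)) = (\<Sum>l<n. d l * (cmod (U $$ (i, l)))\<^sup>2)"
  using assms unitaryD(1)[OF assms(1)]
  by (simp add: spec_mat_index cmod_power2, simp add: power2_eq_square)

lemma psd_diag_nonneg: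
  assumes "H \<in> psd_mats n" "i < n"
  shows "0 \<le> Re (H $$ (i, i))"
  using assms by (elim psd_spectral) (auto simp: Re_spec_mat_diag intro!: sum_nonneg)

lemma eig_prod_1_spec:
  assumes "U \<in> unitary_mats n" "\<And>i j. i \<le> j \<Longrightarrow> j < n \<Longrightarrow> d j \<le> d i" "0 < n"
  shows "eig_prod 1 (spec_mat n U d) = d 0"
  using eig_prod_spec[of U n d 1] assms by auto

text \<open>A diagonal entry is a convex combination of eigenvalues. Together with the trace bound
  below, this avoids computing eigenvalues of products in the counterexamples.\<close>

lemma psd_diag_le_eig_prod_1:
  assumes H: "H \<in> psd_mats n" and i: "i < n"
  shows "Re (H $$ (i, i)) \<le> eig_prod 1 H"
proof -
  obtain U d where U: "U \<in> unitary_mats n" and HU: "H = spec_mat n U d"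
    and d: "\<And>i. i < n \<Longrightarrow> 0 \<le> d i" "\<And>i j. i \<le> j \<Longrightarrow> j < n \<Longrightarrow> d j \<le> d i"
    using psd_spectral[OF H] by blast
  have "(\<Sum>l<n. d l * (cmod (U $$ (i, l)))\<^sup>2) \<le> (\<Sum>l<n. d 0 * (cmod (U $$ (i, l)))\<^sup>2)"
    using d(2) by (intro sum_mono mult_right_mono) auto
  also have "\<dots> = d 0"
    using unitary_row_col_norm(1)[OF U i] by (simp flip: sum_distrib_left)
  also have "d 0 = eig_prod 1 H"
    unfolding HU by (rule eig_prod_1_spec[OF U, symmetric]) (use d i in auto)
  finally show ?thesis
    unfolding HU Re_spec_mat_diag[OF U i] .
qed

lemma trace_spec_mat:
  assumes U: "U \<in> unitary_mats n"
  shows "(\<Sum>i<n. Re (spec_mat n U d $$ (i, i))) = (\<Sum>l<n. d l)"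
proof -
  have "(\<Sum>i<n. Re (spec_mat n U d $$ (i, i))) = (\<Sum>i<n. \<Sum>l<n. d l * (cmod (U $$ (i, l)))\<^sup>2)"
    using Re_spec_mat_diag[OF U] by (intro sum.cong) auto
  also have "\<dots> = (\<Sum>l<n. \<Sum>i<n. d l * (cmod (U $$ (i, l)))\<^sup>2)"
    by (rule sum.swap)
  also have "\<dots> = (\<Sum>l<n. d l)"
    using unitary_row_col_norm(2)[OF U] by (intro sum.cong) (auto simp flip: sum_distrib_left)
  finally show ?thesis .
qed

lemma eig_prod_1_le_trace:
  assumes H: "H \<in> psd_mats n" and n: "0 < n"
  shows "eig_prod 1 H \<le> (\<Sum>i<n. Re (H $$ (i, i)))"
proof -
  obtain U d where U: "U \<in> unitary_mats n" and HU: "H = spec_mat n U d"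
    and d: "\<And>i. i < n \<Longrightarrow> 0 \<le> d i" "\<And>i j. i \<le> j \<Longrightarrow> j < n \<Longrightarrow> d j \<le> d i"
    using psd_spectral[OF H] by blast
  have "eig_prod 1 H = d 0"
    unfolding HU by (rule eig_prod_1_spec[OF U]) (use d n in auto)
  also have "\<dots> \<le> (\<Sum>l<n. d l)"
    using n d by (intro member_le_sum) auto
  finally show ?thesis
    unfolding HU trace_spec_mat[OF U] .
qed

text \<open>All eigenvalues of \<open>C\<close> are at most its trace, so
  \<open>d powr r \<le> t powr (r - 1) * d\<close> for each of them. A small diagonal entry of
  \<open>C\<close> thus stays small in the power.\<close>

lemma mat_rpow_diag_le:
  assumes C: "C \<in> psd_mats n" and i: "i < n" and r: "1 \<le> r"
    and t: "(\<Sum>i<n. Re (C $$ (i, i))) \<le> t"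
  shows "Re (mat_rpow C r $$ (i, i)) \<le> t powr (r - 1) * Re (C $$ (i, i))"
proof -
  obtain U d where U: "U \<in> unitary_mats n" and CU: "C = spec_mat n U d"
    and d: "\<And>i. i < n \<Longrightarrow> 0 \<le> d i"
    using psd_spectral[OF C] by blast
  have "d l powr r \<le> t powr (r - 1) * d l" if l: "l < n" for l
  proof -
    have "d l \<le> (\<Sum>l<n. d l)"
      using l d by (intro member_le_sum) auto
    also have "\<dots> \<le> t"
      using t unfolding CU trace_spec_mat[OF U] .
    finally have "d l powr (r - 1) \<le> t powr (r - 1)"
      using r d[OF l] by (intro powr_mono2) auto
    then have "d l powr (r - 1) * d l \<le> t powr (r - 1) * d l"
      using d[OF l] by (rule mult_right_mono)
    moreover have "d l powr (r - 1) * d l = d l powr r"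
      using d[OF l] powr_add[of "d l" "r - 1" 1] by simp
    ultimately show ?thesis by simp
  qed
  then have "(\<Sum>l<n. d l powr r * (cmod (U $$ (i, l)))\<^sup>2) \<le> (\<Sum>l<n. t powr (r - 1) * d l * (cmod (U $$ (i, l)))\<^sup>2)"
    by (intro sum_mono mult_right_mono) auto
  also have "\<dots> = t powr (r - 1) * Re (C $$ (i, i))"
    unfolding CU Re_spec_mat_diag[OF U i] by (simp add: sum_distrib_left mult.assoc)
  finally have "Re (spec_mat n U (\<lambda>l. d l powr r) $$ (i, i)) \<le> t powr (r - 1) * Re (C $$ (i, i))"
    unfolding Re_spec_mat_diag[OF U i] .
  moreover have "mat_rpow C r = spec_mat n U (\<lambda>l. d l powr r)"
    unfolding CU by (rule mat_rpow_spec[OF U]) (use d in auto)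
  ultimately show ?thesis
    by simp
qed

lemma mat_rpow_pd:
  assumes A: "A \<in> psd_mats n" and e: "eig_prod n A \<noteq> 0"
  shows "mat_rpow A r \<in> pd_mats n"
proof -
  obtain U d where U: "U \<in> unitary_mats n" and AU: "A = spec_mat n U d"
    and d: "\<And>i. i < n \<Longrightarrow> 0 \<le> d i" "\<And>i j. i \<le> j \<Longrightarrow> j < n \<Longrightarrow> d j \<le> d i"
    using psd_spectral[OF A] by blast
  have "eig_prod n A = (\<Prod>i<n. d i)"
    unfolding AU by (rule eig_prod_spec[OF U]) (use d in auto)
  then have "0 < d i powr r" if "i < n" for i
    using e d(1)[OF that] that by auto
  moreover have "mat_rpow A r = spec_mat n U (\<lambda>l. d l powr r)"
    unfolding AU by (rule mat_rpow_spec[OF U]) (use d in auto)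
  ultimately show ?thesis
    using U by (simp add: spec_mat_pd)
qed

section \<open>Diagonal and rotated diagonal 2 by 2 matrices\<close>

lemma trace2: "(\<Sum>i<2. f i) = f 0 + (f (1::nat) :: real)"
  by (simp add: numeral_2_eq_2)

definition diag2 :: "real \<Rightarrow> complex mat" where
  "diag2 a = spec_mat 2 (1\<^sub>m 2) (\<lambda>i. if i = 0 then 1 else a)"

text \<open>The rotation is parametrized by the squared sine of its angle, which makes the diagonal
  entries of \<open>rotdiag2\<close> affine in \<open>\<sigma>\<close>.\<close>

definition rot2 :: "real \<Rightarrow> complex mat" where
  "rot2 \<sigma> = mat 2 2 (\<lambda>(i, j). complex_of_real
     (if i = j then sqrt (1 - \<sigma>) else if i = 0 then - sqrt \<sigma> else sqrt \<sigma>))"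

definition rotdiag2 :: "real \<Rightarrow> real \<Rightarrow> complex mat" where
  "rotdiag2 \<sigma> b = spec_mat 2 (rot2 \<sigma>) (\<lambda>i. if i = 0 then 1 else b)"

lemma one_unitary: "1\<^sub>m n \<in> unitary_mats n"
  by (simp add: unitary_mats_def)

lemma less_2_nat: "(i::nat) < 2 \<longleftrightarrow> i = 0 \<or> i = 1"
  by auto

lemma rot2_unitary:
  assumes "0 \<le> \<sigma>" "\<sigma> \<le> 1"
  shows "rot2 \<sigma> \<in> unitary_mats 2"
proof -
  have "complex_of_real (sqrt \<sigma>) * complex_of_real (sqrt \<sigma>) = \<sigma>"
    "complex_of_real (sqrt (1 - \<sigma>)) * complex_of_real (sqrt (1 - \<sigma>)) = 1 - \<sigma>"
    using assms by (simp_all flip: of_real_mult)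
  then have "mat_adjoint (rot2 \<sigma>) * rot2 \<sigma> = 1\<^sub>m 2"
    by (intro eq_matI) (auto simp: rot2_def scalar_prod_def less_2_nat numeral_2_eq_2)
  then show ?thesis
    by (simp add: unitary_mats_def rot2_def)
qed

lemma diag2_pd: "0 < a \<Longrightarrow> diag2 a \<in> pd_mats 2"
  unfolding diag2_def by (intro spec_mat_pd one_unitary) auto

lemma diag2_rpow: "0 \<le> a \<Longrightarrow> mat_rpow (diag2 a) r = diag2 (a powr r)"
  unfolding diag2_def by (subst mat_rpow_spec[OF one_unitary]) (auto intro!: spec_mat_cong)

lemma rotdiag2_pd: "0 \<le> \<sigma> \<Longrightarrow> \<sigma> \<le> 1 \<Longrightarrow> 0 < b \<Longrightarrow> rotdiag2 \<sigma> b \<in> pd_mats 2"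
  unfolding rotdiag2_def by (intro spec_mat_pd rot2_unitary) auto

lemma rotdiag2_rpow:
  "0 \<le> \<sigma> \<Longrightarrow> \<sigma> \<le> 1 \<Longrightarrow> 0 \<le> b \<Longrightarrow> mat_rpow (rotdiag2 \<sigma> b) r = rotdiag2 \<sigma> (b powr r)"
  unfolding rotdiag2_def by (subst mat_rpow_spec[OF rot2_unitary]) (auto intro!: spec_mat_cong)

lemma rotdiag2_diag:
  assumes "0 \<le> \<sigma>" "\<sigma> \<le> 1"
  shows "Re (rotdiag2 \<sigma> b $$ (0, 0)) = (1 - \<sigma>) + b * \<sigma>"
    "Re (rotdiag2 \<sigma> b $$ (1, 1)) = \<sigma> + b * (1 - \<sigma>)"
  using assms unfolding rotdiag2_def
  by (simp_all only: Re_spec_mat_diag[OF rot2_unitary] trace2 pos2 one_less_numeral_iff semiring_norm)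
    (simp_all add: rot2_def)

lemma diag2_sandwich:
  assumes Z: "Z \<in> carrier_mat 2 2"
  shows "Re ((diag2 a * Z * diag2 a) $$ (0, 0)) = Re (Z $$ (0, 0))"
    "Re ((diag2 a * Z * diag2 a) $$ (1, 1)) = a\<^sup>2 * Re (Z $$ (1, 1))"
proof -
  have D: "diag2 a = mat_diag 2 (\<lambda>i. complex_of_real (if i = 0 then 1 else a))"
    unfolding diag2_def spec_mat_def by (simp add: left_mult_one_mat[of _ 2 2] right_mult_one_mat[of _ 2 2])
  have ZD: "Z * diag2 a = mat 2 2 (\<lambda>(i, j). Z $$ (i, j) * complex_of_real (if j = 0 then 1 else a))"
    unfolding D by (rule mat_diag_mult_right[OF Z])
  have c: "Z * diag2 a \<in> carrier_mat 2 2"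
    unfolding ZD by simp
  have "diag2 a * Z * diag2 a = diag2 a * (Z * diag2 a)"
    using Z by (intro assoc_mult_mat[of _ 2 2 _ 2 _ 2]) (auto simp: D)
  also have "\<dots> = mat 2 2 (\<lambda>(i, j). complex_of_real (if i = 0 then 1 else a) * (Z * diag2 a) $$ (i, j))"
    unfolding D by (rule mat_diag_mult_left) (use c D in simp)
  finally show "Re ((diag2 a * Z * diag2 a) $$ (0, 0)) = Re (Z $$ (0, 0))"
    "Re ((diag2 a * Z * diag2 a) $$ (1, 1)) = a\<^sup>2 * Re (Z $$ (1, 1))"
    unfolding ZD by (simp_all add: power2_eq_square)
qed

lemma powr_neg_div_cancel:
  fixes z :: real
  assumes "1 < \<alpha>"
  shows "(z powr (- p / (\<alpha> - 1))) powr ((1 - \<alpha>) * r) = z powr (p * r)"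
proof -
  have "- p / (\<alpha> - 1) * ((1 - \<alpha>) * r) = p * r"
    using assms by (simp add: field_simps)
  then show ?thesis
    by (simp only: powr_powr)
qed

text \<open>The witnesses are \<open>A = diag(1, x)\<^sup>1\<^sup>/\<^sup>p\<close> with small \<open>x\<close> and the \<open>B\<close> for which \<open>C = A\<^sup>p\<^sup>/\<^sup>2 B\<^sup>p A\<^sup>p\<^sup>/\<^sup>2\<close> has the
  eigenvalues 1 and \<open>x\<close>, with a leading unit eigenvector whose second component is \<open>\<surd>x\<close>.  With
  \<open>T = x powr ((1 - \<alpha>) / p)\<close>, the largest eigenvalue of \<open>SG_tilde\<close> is at least \<open>T\<^sup>2\<close>, while that of the
  Renyi mean is at most a constant times \<open>T\<close>.\<close>

lemma SG_not_log_majorized_renyi: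
  assumes \<alpha>: "1 < \<alpha>" and p: "0 < p" and q: "0 < q"
  shows "\<exists>A \<in> pd_mats 2. \<exists>B \<in> pd_mats 2. \<not> (SG_tilde \<alpha> p A B \<prec>\<^sub>l\<^sub>o\<^sub>g renyi_mean \<alpha> q A B)"
proof -
  \<comment> \<open>The Renyi side will be at most \<open>K * T\<close>: 3 bounds the trace of
    \<open>B0\<close>, and 2 counts the diagonal entries. Taking \<open>T\<close> above
    \<open>K\<close> makes this smaller than \<open>T * T\<close>.\<close>
  define K where "K = (2 * 3 powr (\<alpha> * q / p)) powr (1 / q)"
  define T where "T = K + 1"
  have K: "0 < K" and T: "1 < T"
    by (simp_all add: K_def T_def)
  \<comment> \<open>Chosen so that \<open>x powr (1 - \<alpha>) = T powr p\<close>.\<close>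
  define x where "x = T powr (- p / (\<alpha> - 1))"
  have x: "0 < x" "x < 1"
    using T \<alpha> p by (auto simp: x_def powr_less_one)
  have xpow: "x powr ((1 - \<alpha>) * r) = T powr (p * r)" for r
    unfolding x_def using \<alpha> by (rule powr_neg_div_cancel)
  define A where "A = diag2 (x powr (1 / p))"
  have A_pow: "mat_rpow A r = diag2 (x powr (r / p))" for r
    unfolding A_def using x by (simp add: diag2_rpow powr_powr)
  have A: "A \<in> pd_mats 2"
    unfolding A_def using x by (intro diag2_pd) simp
  then have A': "A \<in> psd_mats 2"
    using pd_subset_psd by blast
  define C where "C = rotdiag2 x x"
  have C: "C \<in> psd_mats 2"
    unfolding C_def using rotdiag2_pd[of x x] pd_subset_psd x by auto
  have C_pow: "mat_rpow C \<alpha> = rotdiag2 x (x powr \<alpha>)"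
    unfolding C_def using x by (intro rotdiag2_rpow) auto
  \<comment> \<open>\<open>C\<close> is prescribed first; \<open>B0\<close> is the matrix for which
    \<open>B0 = mat_rpow B p\<close> gives back this \<open>C\<close>.\<close>
  define B0 where "B0 = mat_rpow A (- p / 2) * C * mat_rpow A (- p / 2)"
  have B0: "B0 \<in> psd_mats 2"
    unfolding B0_def using A' C by (rule mat_rpow_sandwich_psd)
  have B0_diag: "Re (B0 $$ (0, 0)) = Re (C $$ (0, 0))" "Re (B0 $$ (1, 1)) = Re (C $$ (1, 1)) / x"
  proof -
    have e: "(x powr (- p / 2 / p))\<^sup>2 = 1 / x"
      using x p by (simp add: power2_eq_square powr_minus_divide flip: powr_add)
    show "Re (B0 $$ (0, 0)) = Re (C $$ (0, 0))" "Re (B0 $$ (1, 1)) = Re (C $$ (1, 1)) / x"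
      unfolding B0_def A_pow using diag2_sandwich[OF psd_matsD(1)[OF C]] e by simp_all
  qed
  have eig_pd: "eig_prod 2 H \<noteq> 0" if "H = spec_mat 2 U (\<lambda>i. if i = 0 then 1 else b)"
      "U \<in> unitary_mats 2" "b \<noteq> 0" "H \<in> psd_mats 2" for H U b
  proof -
    have "complex_of_real (eig_prod 2 H) = complex_of_real (\<Prod>i<2::nat. if i = 0 then 1 else b)"
      using det_psd[OF that(4)] det_spec[OF that(2)] that(1) by metis
    then show ?thesis
      using that(3) unfolding of_real_eq_iff by (simp add: numeral_2_eq_2)
  qed
  have "eig_prod 2 A \<noteq> 0"
    using eig_pd[OF A_def[unfolded diag2_def] one_unitary _ A'] x by simp
  moreover have "eig_prod 2 C \<noteq> 0"
    using eig_pd[OF C_def[unfolded rotdiag2_def] rot2_unitary _ C] x by simp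
  ultimately have B0_eig: "eig_prod 2 B0 \<noteq> 0"
    unfolding B0_def eig_prod_full_sandwich[OF A' C] by simp
  define B where "B = mat_rpow B0 (1 / p)"
  have B: "B \<in> pd_mats 2"
    unfolding B_def using B0 B0_eig by (rule mat_rpow_pd)
  then have B': "B \<in> psd_mats 2"
    using pd_subset_psd by blast
  have B_pow: "mat_rpow B r = mat_rpow B0 (r / p)" for r
    unfolding B_def mat_rpow_rpow[OF B0] by simp
  have Bp: "mat_rpow B p = B0"
    using B_pow[of p] p mat_rpow_one[OF B0] by simp
  have "diag2 1 = 1\<^sub>m 2"
    unfolding diag2_def using spec_mat_one[OF one_unitary, of 2] by (simp add: if_distrib cong: if_cong)
  then have "mat_rpow A 0 = 1\<^sub>m 2"
    using A_pow[of 0] x by simp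
  then have "mat_rpow A (p/2) * B0 * mat_rpow A (p/2) = C"
    unfolding B0_def mat_rpow_sandwich_sandwich[OF A' psd_matsD(1)[OF C]]
    using psd_matsD(1)[OF C] by simp
  then have core: "SG_core \<alpha> p A B = diag2 (x powr (1/2 - \<alpha>)) * rotdiag2 x (x powr \<alpha>) * diag2 (x powr (1/2 - \<alpha>))"
    unfolding SG_core_def Bp using C_pow A_pow p by simp
  \<comment> \<open>The eigenvalue 1 of \<open>C\<close> survives the power \<alpha>, so the lower
    diagonal entry of that power is still at least \<open>x\<close>. Multiplied by
    \<open>x powr (1 - 2 * \<alpha>)\<close> this yields \<open>T powr (2 * p)\<close>.\<close>
  have "T powr (2 * p) \<le> Re (SG_core \<alpha> p A B $$ (1, 1))"
  proof -
    have "T powr (2 * p) = x powr (2 * (1/2 - \<alpha>)) * x"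
      using xpow[of 2] x powr_add[of x "2 * (1/2 - \<alpha>)" 1] by (simp add: algebra_simps)
    also have "\<dots> \<le> x powr (2 * (1/2 - \<alpha>)) * (x + x powr \<alpha> * (1 - x))"
      using x by (intro mult_left_mono) auto
    also have "\<dots> = (x powr (1/2 - \<alpha>))\<^sup>2 * Re (rotdiag2 x (x powr \<alpha>) $$ (1, 1))"
      using rotdiag2_diag(2)[of x] x by (simp add: power2_eq_square flip: powr_add)
    also have "\<dots> = Re (SG_core \<alpha> p A B $$ (1, 1))"
      unfolding core using diag2_sandwich(2)[of "rotdiag2 x (x powr \<alpha>)"] psd_matsD(1)[OF mat_rpow_psd[OF C], of \<alpha>] C_pow
      by simp
    finally show ?thesis .
  qed
  also have "\<dots> \<le> eig_prod 1 (SG_core \<alpha> p A B)"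
    using SG_core_psd[OF A' B'] by (rule psd_diag_le_eig_prod_1) simp
  finally have "(T powr (2 * p)) powr (1 / p) \<le> eig_prod 1 (SG_core \<alpha> p A B) powr (1 / p)"
    using p by (intro powr_mono2) auto
  then have SG: "T * T \<le> eig_prod 1 (SG_tilde \<alpha> p A B)"
    using eig_prod_SG_tilde[OF A' B' p, of 1 \<alpha>] p T by (simp add: powr_powr power2_eq_square)
  have "eig_prod 1 B0 \<le> 3"
  proof -
    have "eig_prod 1 B0 \<le> (\<Sum>i<2. Re (B0 $$ (i, i)))"
      using B0 by (rule eig_prod_1_le_trace) simp
    \<comment> \<open>Dividing the lower entry of \<open>C\<close> by \<open>x\<close> is harmless
      because this entry is itself of order \<open>x\<close>. Hence \<open>B0\<close> stays bounded
      as \<open>x\<close> tends to 0.\<close>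
    also have "\<dots> = ((1 - x) + x * x) + (x + x * (1 - x)) / x"
      unfolding trace2 B0_diag using rotdiag2_diag[of x x] x by (simp add: C_def)
    also have "\<dots> = (1 - x) + x * x + (1 + (1 - x))"
      using x by (simp add: field_simps)
    also have "\<dots> \<le> 3"
      using x mult_left_le[of x x] by simp
    finally show ?thesis .
  qed
  then have "eig_prod 1 B0 powr (\<alpha> * q / p) \<le> 3 powr (\<alpha> * q / p)"
    using \<alpha> p q eig_prod_nonneg[OF B0, of 1] by (intro powr_mono2) auto
  then have "eig_prod 1 (mat_rpow B (\<alpha> * q)) \<le> 3 powr (\<alpha> * q / p)"
    unfolding B_pow using eig_prod_rpow[OF B0, of 1 "\<alpha> * q / p"] \<alpha> p q by simp
  then have B_diag: "Re (mat_rpow B (\<alpha> * q) $$ (i, i)) \<le> 3 powr (\<alpha> * q / p)" if "i < 2" for i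
    using psd_diag_le_eig_prod_1[OF mat_rpow_psd[OF B'] that, of "\<alpha> * q"] by linarith
  let ?R = "mat_rpow A ((1 - \<alpha>) / 2 * q) * mat_rpow B (\<alpha> * q) * mat_rpow A ((1 - \<alpha>) / 2 * q)"
  have "eig_prod 1 ?R \<le> (\<Sum>i<2. Re (?R $$ (i, i)))"
    by (rule eig_prod_1_le_trace[OF mat_rpow_sandwich_psd[OF A' mat_rpow_psd[OF B']]]) simp
  also have "\<dots> = Re (mat_rpow B (\<alpha> * q) $$ (0, 0)) + T powr q * Re (mat_rpow B (\<alpha> * q) $$ (1, 1))"
  proof -
    have "(x powr ((1 - \<alpha>) / 2 * q / p))\<^sup>2 = x powr ((1 - \<alpha>) * (q / p))"
      by (simp add: power2_eq_square mult.commute flip: powr_add)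
    also have "\<dots> = T powr q"
      unfolding xpow using p by simp
    finally show ?thesis
      unfolding trace2 A_pow using diag2_sandwich[OF psd_matsD(1)[OF mat_rpow_psd[OF B']]] by simp
  qed
  also have "\<dots> \<le> T powr q * 3 powr (\<alpha> * q / p) + T powr q * 3 powr (\<alpha> * q / p)"
  proof (rule add_mono)
    have "1 * Re (mat_rpow B (\<alpha> * q) $$ (0, 0)) \<le> T powr q * 3 powr (\<alpha> * q / p)"
      using B_diag[of 0] T q psd_diag_nonneg[OF mat_rpow_psd[OF B'], of 0]
      by (intro mult_mono) (auto intro: ge_one_powr_ge_zero)
    then show "Re (mat_rpow B (\<alpha> * q) $$ (0, 0)) \<le> T powr q * 3 powr (\<alpha> * q / p)"
      by simp
    show "T powr q * Re (mat_rpow B (\<alpha> * q) $$ (1, 1)) \<le> T powr q * 3 powr (\<alpha> * q / p)"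
      using B_diag[of 1] by (intro mult_left_mono) auto
  qed
  finally have "eig_prod 1 ?R \<le> T powr q * (2 * 3 powr (\<alpha> * q / p))"
    by simp
  then have "eig_prod 1 ?R powr (1 / q) \<le> (T powr q * (2 * 3 powr (\<alpha> * q / p))) powr (1 / q)"
    using q eig_prod_nonneg[OF mat_rpow_sandwich_psd[OF A' mat_rpow_psd[OF B']], of 1] by (intro powr_mono2) auto
  also have "\<dots> = T * K"
    using q T unfolding K_def by (subst powr_mult) (simp_all add: powr_powr)
  also have "\<dots> < T * T"
    using K T by (simp add: T_def)
  finally have "eig_prod 1 (renyi_mean \<alpha> q A B) < T * T"
    using eig_prod_renyi_mean[OF A' B' _ q, of 1 \<alpha>] by simp
  then have "\<not> eig_prod 1 (SG_tilde \<alpha> p A B) \<le> eig_prod 1 (renyi_mean \<alpha> q A B)"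
    using SG by linarith
  then have "\<not> (SG_tilde \<alpha> p A B \<prec>\<^sub>l\<^sub>o\<^sub>g renyi_mean \<alpha> q A B)"
    unfolding log_majorized_iff_eig_prod[OF psd_matsD(3)[OF SG_tilde_psd[OF A' B' p]]] by auto
  then show ?thesis
    using A B by blast
qed

text \<open>Here \<open>A = diag(1, u powr (- 1 / (\<alpha> - 1)))\<close>, and \<open>B\<^sup>p\<close> is a small perturbation of the rank-one
  projection onto a vector whose second component has squared modulus \<open>u powr (- 2 * p)\<close>.  As \<open>u\<close>
  grows, the largest eigenvalue of \<open>SG_tilde\<close> stays bounded, whereas that of the Renyi mean is at
  least \<open>u powr ((q - 2 * p) / q)\<close>.\<close>

lemma renyi_not_log_majorized_SG:
  assumes \<alpha>: "1 < \<alpha>" and p: "0 < p" and q: "2 * p < q"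
  shows "\<exists>A \<in> pd_mats 2. \<exists>B \<in> pd_mats 2. \<not> (renyi_mean \<alpha> q A B \<prec>\<^sub>l\<^sub>o\<^sub>g SG_tilde \<alpha> p A B)"
proof -
  have q0: "0 < q"
    using p q by simp
  \<comment> \<open>\<open>SG_tilde\<close> will be at most \<open>3 powr (\<alpha> / p)\<close>,
    where 3 bounds the trace of \<open>C\<close>. The choice of \<open>u\<close> makes the lower
    bound for the Renyi mean equal to \<open>L\<close>; its exponent is positive because q >
    2p.\<close>
  define L where "L = 3 powr (\<alpha> / p) + 1"
  have L: "1 < L"
    by (simp add: L_def)
  define u where "u = L powr (q / (q - 2 * p))"
  have u: "1 < u"
    using L q q0 by (auto simp: u_def intro: gr_one_powr)
  define a where "a = u powr (- 1 / (\<alpha> - 1))"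
  have a: "0 < a" "a \<le> 1"
    using u \<alpha> by (auto simp: a_def powr_le_one_le intro!: less_imp_le[OF powr_less_one])
  have apow: "a powr ((1 - \<alpha>) * r) = u powr r" for r
    unfolding a_def using powr_neg_div_cancel[OF \<alpha>, of u 1 r] by simp
  \<comment> \<open>The largest order of \<open>\<sigma>\<close> that keeps \<open>SG_core\<close>
    bounded: its lower diagonal entry is at most a constant times
    \<open>a powr ((1 - \<alpha>) * (2 * p)) * \<sigma>\<close>, and this product is now 1.\<close>
  define \<sigma> where "\<sigma> = u powr (- 2 * p)"
  have \<sigma>: "0 < \<sigma>" "\<sigma> \<le> 1"
    using u p by (auto simp: \<sigma>_def intro!: less_imp_le[OF powr_less_one])
  define A where "A = diag2 a"
  \<comment> \<open>\<open>mat_rpow B p\<close> has eigenvalues 1 and \<open>\<sigma>\<close>: the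
    second one makes \<open>B\<close> definite and is of the order already present in the lower
    diagonal entry.\<close>
  define B where "B = rotdiag2 \<sigma> (\<sigma> powr (1 / p))"
  have A: "A \<in> pd_mats 2" and B: "B \<in> pd_mats 2"
    using a \<sigma> by (auto simp: A_def B_def intro!: diag2_pd rotdiag2_pd)
  then have A': "A \<in> psd_mats 2" and B': "B \<in> psd_mats 2"
    using pd_subset_psd by blast+
  have A_pow: "mat_rpow A r = diag2 (a powr r)" for r
    unfolding A_def using a by (intro diag2_rpow) simp
  have B_pow: "mat_rpow B r = rotdiag2 \<sigma> (\<sigma> powr (r / p))" for r
    unfolding B_def using \<sigma> by (subst rotdiag2_rpow) (auto simp: powr_powr)
  have B_diag: "Re (mat_rpow B r $$ (0, 0)) = (1 - \<sigma>) + \<sigma> powr (r / p) * \<sigma>"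
    "Re (mat_rpow B r $$ (1, 1)) = \<sigma> + \<sigma> powr (r / p) * (1 - \<sigma>)" for r
    unfolding B_pow using rotdiag2_diag[of \<sigma>] \<sigma> by auto
  note Bc = psd_matsD(1)[OF mat_rpow_psd[OF B']]
  have sq: "(a powr r)\<^sup>2 = a powr (2 * r)" for r
    by (simp add: power2_eq_square flip: powr_add)
  let ?R = "mat_rpow A ((1 - \<alpha>) / 2 * q) * mat_rpow B (\<alpha> * q) * mat_rpow A ((1 - \<alpha>) / 2 * q)"
  have "L powr q = u powr (q - 2 * p)"
    using q by (simp add: u_def powr_powr)
  also have "\<dots> = u powr q * \<sigma>"
    unfolding \<sigma>_def powr_add[symmetric] by simp
  also have "\<dots> \<le> u powr q * Re (mat_rpow B (\<alpha> * q) $$ (1, 1))"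
    unfolding B_diag using \<sigma> by (intro mult_left_mono) auto
  also have "\<dots> = Re (?R $$ (1, 1))"
    unfolding A_pow using diag2_sandwich(2)[OF Bc] apow[of q] by (simp add: sq)
  also have "\<dots> \<le> eig_prod 1 ?R"
    by (rule psd_diag_le_eig_prod_1[OF mat_rpow_sandwich_psd[OF A' mat_rpow_psd[OF B']]]) simp
  finally have "(L powr q) powr (1 / q) \<le> eig_prod 1 ?R powr (1 / q)"
    using q0 by (intro powr_mono2) auto
  then have R: "L \<le> eig_prod 1 (renyi_mean \<alpha> q A B)"
    using eig_prod_renyi_mean[OF A' B' _ q0, of 1 \<alpha>] q0 L by (simp add: powr_powr)
  define C where "C = mat_rpow A (p/2) * mat_rpow B p * mat_rpow A (p/2)"
  have C: "C \<in> psd_mats 2"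
    unfolding C_def using A' B' by (intro mat_rpow_psd mat_rpow_sandwich_psd)
  have C_diag: "Re (C $$ (0, 0)) = (1 - \<sigma>) + \<sigma> * \<sigma>" "Re (C $$ (1, 1)) = a powr p * (\<sigma> + \<sigma> * (1 - \<sigma>))"
    unfolding C_def A_pow using diag2_sandwich[OF Bc] B_diag[of p] p \<sigma> by (simp_all add: sq)
  have s2: "\<sigma> * \<sigma> \<le> \<sigma>" "\<sigma> * (1 - \<sigma>) \<le> \<sigma>"
    using \<sigma> by (auto simp: mult_left_le)
  have C0: "Re (C $$ (0, 0)) \<le> 1" and C1: "Re (C $$ (1, 1)) \<le> a powr p * (2 * \<sigma>)"
    unfolding C_diag using s2 by (auto intro!: mult_left_mono)
  have "a powr p * (2 * \<sigma>) \<le> 1 * 2"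
    using a \<sigma> p by (intro mult_mono) (auto intro: powr_le1)
  then have tr: "(\<Sum>i<2. Re (C $$ (i, i))) \<le> 3"
    unfolding trace2 using C0 C1 by linarith
  have Ca: "Re (mat_rpow C \<alpha> $$ (i, i)) \<le> 3 powr (\<alpha> - 1) * Re (C $$ (i, i))" if "i < 2" for i
    using mat_rpow_diag_le[OF C that _ tr, of \<alpha>] \<alpha> by simp
  have core: "SG_core \<alpha> p A B = diag2 (a powr ((1/2 - \<alpha>) * p)) * mat_rpow C \<alpha> * diag2 (a powr ((1/2 - \<alpha>) * p))"
    by (simp add: SG_core_def C_def A_pow)
  have "eig_prod 1 (SG_core \<alpha> p A B) \<le> (\<Sum>i<2. Re (SG_core \<alpha> p A B $$ (i, i)))"
    using SG_core_psd[OF A' B'] by (rule eig_prod_1_le_trace) simp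
  also have "\<dots> = Re (mat_rpow C \<alpha> $$ (0, 0)) + a powr (2 * ((1/2 - \<alpha>) * p)) * Re (mat_rpow C \<alpha> $$ (1, 1))"
    unfolding core trace2 using diag2_sandwich[OF psd_matsD(1)[OF mat_rpow_psd[OF C]]] by (simp add: sq)
  also have "\<dots> \<le> 3 powr (\<alpha> - 1) * 1 + a powr (2 * ((1/2 - \<alpha>) * p)) * (3 powr (\<alpha> - 1) * (a powr p * (2 * \<sigma>)))"
  proof (intro add_mono mult_left_mono)
    show "Re (mat_rpow C \<alpha> $$ (0, 0)) \<le> 3 powr (\<alpha> - 1) * 1"
      by (rule order_trans[OF Ca mult_left_mono[OF C0]]) auto
    show "Re (mat_rpow C \<alpha> $$ (1, 1)) \<le> 3 powr (\<alpha> - 1) * (a powr p * (2 * \<sigma>))"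
      by (rule order_trans[OF Ca mult_left_mono[OF C1]]) auto
  qed simp
  also have "\<dots> = 3 powr (\<alpha> - 1) * (1 + 2 * (a powr (2 * ((1/2 - \<alpha>) * p)) * a powr p * \<sigma>))"
    by (simp add: algebra_simps)
  also have "a powr (2 * ((1/2 - \<alpha>) * p)) * a powr p = a powr ((1 - \<alpha>) * (2 * p))"
    unfolding powr_add[symmetric] by (simp add: algebra_simps)
  also have "\<dots> * \<sigma> = 1"
    unfolding apow \<sigma>_def powr_add[symmetric] using u by simp
  also have "3 powr (\<alpha> - 1) * (1 + 2 * 1) = (3::real) powr \<alpha>"
    using powr_add[of "3::real" "\<alpha> - 1" 1] by simp
  finally have "eig_prod 1 (SG_core \<alpha> p A B) powr (1 / p) \<le> (3 powr \<alpha>) powr (1 / p)"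
    using p eig_prod_nonneg[OF SG_core_psd[OF A' B'], of 1] by (intro powr_mono2) auto
  then have "eig_prod 1 (SG_tilde \<alpha> p A B) \<le> 3 powr (\<alpha> / p)"
    using eig_prod_SG_tilde[OF A' B' p, of 1 \<alpha>] by (simp add: powr_powr)
  then have "\<not> eig_prod 1 (renyi_mean \<alpha> q A B) \<le> eig_prod 1 (SG_tilde \<alpha> p A B)"
    using R by (simp add: L_def)
  then have "\<not> (renyi_mean \<alpha> q A B \<prec>\<^sub>l\<^sub>o\<^sub>g SG_tilde \<alpha> p A B)"
    unfolding log_majorized_iff_eig_prod[OF psd_matsD(3)[OF renyi_mean_psd[OF A' B']]] by auto
  then show ?thesis
    using A B by blast
qed

theorem theorem3p7:
  fixes \<alpha> p q :: real
  assumes "\<alpha> > 1" and "p > 0" and "q > 0"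
  shows "(\<exists>A \<in> pd_mats 2. \<exists>B \<in> pd_mats 2.
            \<not> (SG_tilde \<alpha> p A B \<prec>\<^sub>l\<^sub>o\<^sub>g renyi_mean \<alpha> q A B)) \<and>
         (p / q \<ge> \<alpha> \<longrightarrow>
            (\<forall>n \<ge> 1. \<forall>A \<in> psd_mats n. \<forall>B \<in> psd_mats n.
               loewner_le (support_proj B) (support_proj A) \<longrightarrow>
               renyi_mean \<alpha> q A B \<prec>\<^sub>l\<^sub>o\<^sub>g SG_tilde \<alpha> p A B)) \<and>
         ((\<forall>A \<in> pd_mats 2. \<forall>B \<in> pd_mats 2.
               renyi_mean \<alpha> q A B \<prec>\<^sub>l\<^sub>o\<^sub>g SG_tilde \<alpha> p A B) \<longrightarrow>
            p / q \<ge> 1 / 2)"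
proof (intro conjI impI allI ballI)
  show "\<exists>A \<in> pd_mats 2. \<exists>B \<in> pd_mats 2. \<not> (SG_tilde \<alpha> p A B \<prec>\<^sub>l\<^sub>o\<^sub>g renyi_mean \<alpha> q A B)"
    using assms by (rule SG_not_log_majorized_renyi)
next
  fix n and A B :: "complex mat"
  assume "p / q \<ge> \<alpha>" "A \<in> psd_mats n" "B \<in> psd_mats n"
  then show "renyi_mean \<alpha> q A B \<prec>\<^sub>l\<^sub>o\<^sub>g SG_tilde \<alpha> p A B"
    using assms by (intro renyi_log_majorized_SG)
next
  assume all: "\<forall>A \<in> pd_mats 2. \<forall>B \<in> pd_mats 2. renyi_mean \<alpha> q A B \<prec>\<^sub>l\<^sub>o\<^sub>g SG_tilde \<alpha> p A B"
  show "p / q \<ge> 1 / 2"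
  proof (rule ccontr)
    assume "\<not> p / q \<ge> 1 / 2"
    then have "2 * p < q"
      using assms by (simp add: field_simps)
    with all renyi_not_log_majorized_SG[OF assms(1,2)] show False
      by blast
  qed
qed

end
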